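(* Let $a\ge 2$ be an integer, and let $\mathcal{U}_{a,a,a}$ be the upper cluster algebra of the seed $((x_1,x_2,x_3),B_{a,a,a})$ with no frozen variables, where $$B_{a,a,a}=\begin{bmatrix}0&-a&a\\ a&0&-a\\ -a&a&0\end{bmatrix}.$$ Then $\mathcal{U}_{a,a,a}$ is generated over $\mathbb{Z}$ by $$x_1,\ x_2,\ x_3,\quad M:=\frac{x_1^a+x_2^a+x_3^a}{x_1x_2x_3}.$$ The ideal of relations among these generators is generated by $$x_1x_2x_3M-x_1^a-x_2^a-x_3^a=0.$$
   Context: A seed with $n=m=3$ (three mutable variables, no frozen variables) is a pair $(\mathbf{x},B)$ where $\mathbf{x}=(x_1,x_2,x_3)$ freely generates the field $\mathcal{F}=\mathbb{Q}(x_1,x_2,x_3)$ over $\mathbb{Q}$ and $B$ is a $3\times3$ skew-symmetric integer matrix. For $1\le k\le 3$ the mutation of $(\mathbf{x},B)$ at $k$ is the seed $(\mathbf{x}',B')$ with $x_i'=x_i$ for $i\neq k$, $x_k'=\left(\prod_{B_{jk}>0}x_j^{B_{jk}}+\prod_{B_{jk}<0}x_j^{-B_{jk}}\right)x_k^{-1}$, and $B'_{ij}=-B_{ij}$ if $i=k$ or $j=k$, $B'_{ij}=B_{ij}+\frac{|B_{ik}|B_{kj}+B_{ik}|B_{kj}|}{2}$ otherwise. Mutation-equivalence is the equivalence relation generated by mutations and simultaneous permutations of indices. The clusters are the sets $\{y_1,y_2,y_3\}$ of variables of seeds mutation-equivalent to the initial seed. The upper cluster algebra is $\mathcal{U}=\bigcap_{\text{clusters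 }\{y_1,y_2,y_3\}}\mathbb{Z}[y_1^{\pm1},y_2^{\pm1},y_3^{\pm1}]\subset\mathcal{F}$. The ideal of relations is the kernel of the surjection onto $\mathcal{U}$ from the polynomial ring over $\mathbb{Z}$ on symbols for the listed generators. *)

theory Defs
  imports "HOL-Analysis.Analysis" "HOL-Library.Poly_Mapping"
begin

text \<open>Polynomials with coefficients in \<open>'a\<close> on symbols indexed by the finite type \<open>'n\<close>:
  a monomial is an exponent vector \<open>'n \<Rightarrow>\<^sub>0 nat\<close>, and multiplication is convolution.\<close>

type_synonym ('n, 'a) poly_ring = "('n \<Rightarrow>\<^sub>0 nat) \<Rightarrow>\<^sub>0 'a"

definition symb :: "'n \<Rightarrow> ('n, 'a::zero_neq_one) poly_ring" where
  "symb i = Poly_Mapping.single (Poly_Mapping.single i 1) 1"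

definition poly_eval ::
  "('a::zero \<Rightarrow> 'f::comm_ring_1) \<Rightarrow> 'f ^ 'n::finite \<Rightarrow> ('n, 'a) poly_ring \<Rightarrow> 'f" where
  "poly_eval c y p =
     (\<Sum>m\<in>Poly_Mapping.keys p.
        c (Poly_Mapping.lookup p m) * (\<Prod>i\<in>UNIV. y $ i ^ Poly_Mapping.lookup m i))"

definition relation_ideal ::
  "'f::comm_ring_1 ^ 'n::finite \<Rightarrow> ('n, int) poly_ring set" where
  "relation_ideal y = {p. poly_eval of_int y p = 0}"

text \<open>A submodule of a commutative ring, acting on itself by multiplication, is an ideal.\<close>

abbreviation ideal_generated :: "'a::comm_ring_1 set \<Rightarrow> 'a set" where
  "ideal_generated S \<equiv> module.span (*) S"

definition is_subring :: "'f::ring_1 set \<Rightarrow> bool" where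
  "is_subring R \<longleftrightarrow> 1 \<in> R \<and> (\<forall>u\<in>R. \<forall>v\<in>R. u - v \<in> R \<and> u * v \<in> R)"

definition subring_generated :: "'f::ring_1 set \<Rightarrow> 'f set" where
  "subring_generated S = \<Inter>{R. is_subring R \<and> S \<subseteq> R}"

definition is_subfield :: "'f::field set \<Rightarrow> bool" where
  "is_subfield K \<longleftrightarrow> is_subring K \<and> (\<forall>u\<in>K. inverse u \<in> K)"

definition subfield_generated :: "'f::field set \<Rightarrow> 'f set" where
  "subfield_generated S = \<Inter>{K. is_subfield K \<and> S \<subseteq> K}"

text \<open>The ambient field is the whole type \<open>'f\<close>. Every subfield of a field of characteristic 0
  contains the rationals, so the second conjunct says that \<open>x\<close> generates it over the rationals.\<close>

definition freely_generates :: "'f::field_char_0 ^ 'n::finite \<Rightarrow> bool" where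
  "freely_generates x \<longleftrightarrow>
     (\<forall>p. poly_eval of_rat x p = 0 \<longrightarrow> p = 0) \<and>
     subfield_generated (range (($) x)) = UNIV"

type_synonym ('f, 'n) seed = "('f ^ 'n) \<times> (int ^ 'n ^ 'n)"

definition is_seed :: "('f::field_char_0, 'n::finite) seed \<Rightarrow> bool" where
  "is_seed s \<longleftrightarrow> freely_generates (fst s) \<and> transpose (snd s) = - snd s"

definition mutate_vars ::
  "'n::finite \<Rightarrow> 'f::field ^ 'n \<Rightarrow> int ^ 'n ^ 'n \<Rightarrow> 'f ^ 'n" where
  "mutate_vars k x B =
     (\<chi> i. if i = k
        then ((\<Prod>j | B $ j $ k > 0. x $ j ^ nat (B $ j $ k)) +
              (\<Prod>j | B $ j $ k < 0. x $ j ^ nat (- (B $ j $ k)))) * inverse (x $ k)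
        else x $ i)"

text \<open>The numerator below is always even, so the integer division is exact.\<close>

definition mutate_matrix :: "'n::finite \<Rightarrow> int ^ 'n ^ 'n \<Rightarrow> int ^ 'n ^ 'n" where
  "mutate_matrix k B =
     (\<chi> i j. if i = k \<or> j = k then - (B $ i $ j)
        else B $ i $ j + (\<bar>B $ i $ k\<bar> * B $ k $ j + B $ i $ k * \<bar>B $ k $ j\<bar>) div 2)"

definition mutate :: "'n::finite \<Rightarrow> ('f::field, 'n) seed \<Rightarrow> ('f, 'n) seed" where
  "mutate k s = (mutate_vars k (fst s) (snd s), mutate_matrix k (snd s))"

definition permute_seed :: "('n::finite \<Rightarrow> 'n) \<Rightarrow> ('f, 'n) seed \<Rightarrow> ('f, 'n) seed" where
  "permute_seed p s = ((\<chi> i. fst s $ p i), (\<chi> i j. snd s $ p i $ p j))"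

definition seed_step :: "('f::field_char_0, 'n::finite) seed \<Rightarrow> ('f, 'n) seed \<Rightarrow> bool" where
  "seed_step s t \<longleftrightarrow>
     is_seed s \<and> is_seed t \<and> ((\<exists>k. t = mutate k s) \<or> (\<exists>p. bij p \<and> t = permute_seed p s))"

definition mutation_equivalent ::
  "('f::field_char_0, 'n::finite) seed \<Rightarrow> ('f, 'n) seed \<Rightarrow> bool" where
  "mutation_equivalent = equivclp seed_step"

definition clusters :: "('f::field_char_0, 'n::finite) seed \<Rightarrow> 'f set set" where
  "clusters s = {range (($) (fst t)) |t. mutation_equivalent s t}"

definition laurent_ring :: "'f::field set \<Rightarrow> 'f set" where
  "laurent_ring Y = subring_generated (Y \<union> inverse ` Y)"

definition upper_cluster_algebra :: "('f::field_char_0, 'n::finite) seed \<Rightarrow> 'f set" where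
  "upper_cluster_algebra s = (\<Inter>Y\<in>clusters s. laurent_ring Y)"

definition B_matrix :: "nat \<Rightarrow> int ^ 3 ^ 3" where
  "B_matrix a = vector
     [vector [      0, - int a,   int a],
      vector [  int a,       0, - int a],
      vector [- int a,   int a,       0]]"

end

theory Submission
  imports Defs "HOL-Computational_Algebra.Polynomial"
begin

text \<open>Every Laurent ring of a cluster contains \<open>x1, x2, x3, M\<close>: an element of the Laurent rings of a
  seed and of its three neighbours lies in the Laurent rings of the neighbours of each neighbour,
  because the matrices stay mutation-cyclic. Conversely, an element \<open>f\<close> of the Laurent
  rings of the initial seed and its neighbours is, up to a power of any two of the variables, in
  \<open>S = \<int>[x1, x2, x3, M]\<close>, since \<open>x1' = x2 x3 M - x1^(a-1)\<close>; as any two of the variables form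
  a regular sequence in \<open>S\<close>, this puts \<open>f\<close> in \<open>S\<close>. The relations are the multiples of
  \<open>x1 x2 x3 M - (x1^a + x2^a + x3^a)\<close>, by Gauss's lemma for this linear polynomial in \<open>M\<close>, whose
  coefficients are coprime in \<open>\<int>[x1, x2, x3]\<close>.\<close>

section \<open>Laurent expansions\<close>

text \<open>For \<open>a > 2\<close> a mutation leaves the family \<open>B_matrix a\<close>, and the
  formula for \<open>M\<close> loses its symmetric shape, so \<open>M\<close> cannot be checked
  cluster by cluster. Membership in the Laurent rings of a seed and of its neighbours is carried as
  an invariant instead. Each step is a rank two problem: two directions \<open>u\<close>,
  \<open>v\<close> are mutated while \<open>w\<close> stays invertible. Cyclicity of the matrix
  enters there twice. It makes every exchange numerator a sum of one power of each of the other two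
  variables, such as \<open>v^b + w^c\<close>, and it gives the relation \<open>d + e = b c\<close>
  between exponents before and after a mutation. It would be lost if an entry \<open>q r - p\<close>
  dropped below 2; the bound 4 on the Markov constant excludes this. Initially the constant is
  \<open>3 a^2 - a^3\<close>, which is 4 for \<open>a = 2\<close> and at most 0 for
  \<open>a >= 3\<close>. All rings are subsets of one field, so coefficients can be compared only
  through transcendence. Each variable of a cluster is shown to be transcendental over the subfield
  generated by the other two, and this serves as the working form of free generation.\<close>

lemma is_subring_Inter:
  assumes "\<And>R. R \<in> \<R> \<Longrightarrow> is_subring R"
  shows "is_subring (\<Inter>\<R>)"
  using assms unfolding is_subring_def by simp

section \<open>Subrings of a fixed ring, and Laurent rings\<close>

context
  fixes R :: "'f::comm_ring_1 set"
  assumes R: "is_subring R"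
begin

lemma subring_1: "1 \<in> R"
  using R unfolding is_subring_def by blast

lemma subring_diff: "u \<in> R \<Longrightarrow> v \<in> R \<Longrightarrow> u - v \<in> R"
  using R unfolding is_subring_def by blast

lemma subring_mult: "u \<in> R \<Longrightarrow> v \<in> R \<Longrightarrow> u * v \<in> R"
  using R unfolding is_subring_def by blast

lemma subring_0: "0 \<in> R"
  using subring_diff[OF subring_1 subring_1] by simp

lemma subring_uminus: "u \<in> R \<Longrightarrow> - u \<in> R"
  using subring_diff[OF subring_0, of u] by simp

lemma subring_add: "u \<in> R \<Longrightarrow> v \<in> R \<Longrightarrow> u + v \<in> R"
  using subring_diff[OF _ subring_uminus, of u v] by simp

lemma subring_power: "u \<in> R \<Longrightarrow> u ^ n \<in> R"
  by (induction n) (auto intro: subring_1 subring_mult)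

lemma subring_sum: "(\<And>i. i \<in> A \<Longrightarrow> f i \<in> R) \<Longrightarrow> sum f A \<in> R"
  by (induction A rule: infinite_finite_induct) (auto intro: subring_0 subring_add)

lemma subring_prod: "(\<And>i. i \<in> A \<Longrightarrow> f i \<in> R) \<Longrightarrow> prod f A \<in> R"
  by (induction A rule: infinite_finite_induct) (auto intro: subring_1 subring_mult)

lemma subring_of_nat: "of_nat n \<in> R"
  by (induction n) (auto intro: subring_0 subring_1 subring_add)

lemma subring_of_int: "of_int n \<in> R"
proof (cases n)
  case (nonneg k)
  then show ?thesis using subring_of_nat[of k] by simp
next
  case (neg k)
  then show ?thesis using subring_uminus[OF subring_of_nat[of "Suc k"]] by (simp del: of_nat_Suc)
qed

lemmas subring_intros = subring_0 subring_1 subring_add subring_diff subring_uminus subring_mult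
  subring_power subring_sum subring_prod subring_of_int

end

lemma is_subring_generated: "is_subring (subring_generated S)"
  unfolding subring_generated_def by (rule is_subring_Inter) auto

lemma subring_generated_superset: "S \<subseteq> subring_generated S"
  unfolding subring_generated_def by blast

lemma subring_generated_least: "is_subring R \<Longrightarrow> S \<subseteq> R \<Longrightarrow> subring_generated S \<subseteq> R"
  unfolding subring_generated_def by blast

lemma subring_generated_mono: "S \<subseteq> T \<Longrightarrow> subring_generated S \<subseteq> subring_generated T"
  using subring_generated_superset[of T]
  by (intro subring_generated_least is_subring_generated) auto

lemma is_subring_laurent_ring: "is_subring (laurent_ring Y)"
  unfolding laurent_ring_def by (rule is_subring_generated)

lemma laurent_ring_var: "y \<in> Y \<Longrightarrow> y \<in> laurent_ring Y"
  unfolding laurent_ring_def using subring_generated_superset[of "Y \<union> inverse ` Y"] by blast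

lemma laurent_ring_inverse: "y \<in> Y \<Longrightarrow> inverse y \<in> laurent_ring Y"
  unfolding laurent_ring_def using subring_generated_superset[of "Y \<union> inverse ` Y"] by blast

lemma laurent_ring_least:
  assumes "is_subring R" "\<And>y. y \<in> Y \<Longrightarrow> y \<in> R" "\<And>y. y \<in> Y \<Longrightarrow> inverse y \<in> R"
  shows "laurent_ring Y \<subseteq> R"
  unfolding laurent_ring_def by (rule subring_generated_least) (use assms in auto)

lemma laurent_ring_mono: "Y \<subseteq> Z \<Longrightarrow> laurent_ring Y \<subseteq> laurent_ring Z"
  by (rule laurent_ring_least[OF is_subring_laurent_ring])
     (auto intro: laurent_ring_var laurent_ring_inverse)

lemmas laurent_ring_intros = subring_intros[OF is_subring_laurent_ring]

section \<open>Polynomials over a subring, adjunction of an element, transcendence\<close>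

definition polys :: "'f::comm_ring_1 set \<Rightarrow> 'f poly set" where
  "polys E = {p. \<forall>n. coeff p n \<in> E}"

lemma is_subring_polys:
  assumes E: "is_subring E"
  shows "is_subring (polys E)"
  unfolding is_subring_def polys_def mem_Collect_eq
proof (intro conjI ballI allI)
  show "coeff 1 n \<in> E" for n
    by (simp add: coeff_1 subring_0[OF E] subring_1[OF E])
  fix u v n assume "u \<in> {p. \<forall>n. coeff p n \<in> E}" "v \<in> {p. \<forall>n. coeff p n \<in> E}"
  then have *: "coeff u n \<in> E" "coeff v n \<in> E" for n by auto
  show "coeff (u - v) n \<in> E"
    unfolding coeff_diff by (intro subring_diff[OF E] *)
  show "coeff (u * v) n \<in> E"
    unfolding coeff_mult by (intro subring_sum[OF E] subring_mult[OF E] *)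
qed

lemma polys_coeff: "p \<in> polys E \<Longrightarrow> coeff p n \<in> E"
  by (auto simp: polys_def)

lemma polys_monom: "is_subring E \<Longrightarrow> c \<in> E \<Longrightarrow> monom c n \<in> polys E"
  by (auto simp: polys_def intro: subring_0)

lemma polys_pCons: "pCons c p \<in> polys E \<longleftrightarrow> c \<in> E \<and> p \<in> polys E"
proof
  assume "pCons c p \<in> polys E"
  then have *: "coeff (pCons c p) n \<in> E" for n by (auto simp: polys_def)
  show "c \<in> E \<and> p \<in> polys E"
    using *[of 0] *[of "Suc _"] by (auto simp: polys_def)
qed (auto simp: polys_def coeff_pCons split: nat.split)

lemma polys_mono: "E \<subseteq> F \<Longrightarrow> polys E \<subseteq> polys F"
  by (auto simp: polys_def)

lemma polys_poly_in:
  assumes "is_subring R" "E \<subseteq> R" "y \<in> R" "p \<in> polys E"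
  shows "poly p y \<in> R"
  using assms(4)
proof (induction p)
  case 0
  then show ?case by (simp add: subring_0[OF assms(1)])
next
  case (pCons c p)
  then have "c \<in> R" "poly p y \<in> R" using assms(2) by (auto simp: polys_pCons)
  then show ?case
    by (simp add: subring_add[OF assms(1)] subring_mult[OF assms(1)] assms(3))
qed

definition adjoin :: "'f::comm_ring_1 set \<Rightarrow> 'f \<Rightarrow> 'f set" where
  "adjoin E y = (\<lambda>p. poly p y) ` polys E"

lemma is_subring_adjoin:
  assumes "is_subring E"
  shows "is_subring (adjoin E y)"
proof -
  note P = is_subring_polys[OF assms]
  show ?thesis
    unfolding is_subring_def adjoin_def
  proof (intro conjI ballI)
    show "1 \<in> (\<lambda>p. poly p y) ` polys E"
      using subring_1[OF P] by (metis image_eqI poly_1)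
    show "u - v \<in> (\<lambda>p. poly p y) ` polys E" "u * v \<in> (\<lambda>p. poly p y) ` polys E"
      if "u \<in> (\<lambda>p. poly p y) ` polys E" "v \<in> (\<lambda>p. poly p y) ` polys E" for u v
      using that subring_diff[OF P] subring_mult[OF P]
      by (auto simp flip: poly_diff poly_mult)
  qed
qed

lemma adjoin_base: "is_subring E \<Longrightarrow> c \<in> E \<Longrightarrow> c \<in> adjoin E y"
  unfolding adjoin_def
  by (intro image_eqI[of _ _ "[:c:]"]) (auto simp: polys_pCons subring_0 intro: subring_0[OF is_subring_polys])

lemma adjoin_var: "is_subring E \<Longrightarrow> y \<in> adjoin E y"
  unfolding adjoin_def
  by (intro image_eqI[of _ _ "[:0, 1:]"]) (auto simp: polys_pCons subring_0 subring_1 intro: subring_0[OF is_subring_polys])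

lemma adjoin_least: "is_subring R \<Longrightarrow> E \<subseteq> R \<Longrightarrow> y \<in> R \<Longrightarrow> adjoin E y \<subseteq> R"
  by (auto simp: adjoin_def polys_poly_in)

text \<open>The bridge from generated subrings to polynomial expressions in one distinguished
  variable, where coefficients can be compared.\<close>

lemma subring_generated_insert: "subring_generated (insert y S) = adjoin (subring_generated S) y"
proof
  show "subring_generated (insert y S) \<subseteq> adjoin (subring_generated S) y"
    using subring_generated_superset[of S]
    by (intro subring_generated_least is_subring_adjoin)
       (auto intro: is_subring_generated adjoin_base adjoin_var)
  show "adjoin (subring_generated S) y \<subseteq> subring_generated (insert y S)"
    using subring_generated_superset[of "insert y S"]
    by (intro adjoin_least is_subring_generated subring_generated_mono) auto
qed

lemma adjoinE:
  assumes "d \<in> adjoin E y"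
  obtains c d' where "c \<in> E" "d' \<in> adjoin E y" "d = c + y * d'"
proof -
  obtain p where p: "p \<in> polys E" "d = poly p y"
    using assms by (auto simp: adjoin_def)
  then show ?thesis
    by (cases p) (auto simp: polys_pCons adjoin_def intro!: that)
qed

text \<open>\<open>E[y, 1/y]\<close>, in the form in which it is used: some power of
  \<open>y\<close> clears the denominator. For \<open>y = 0\<close> this is the whole field, so the
  inclusion of Laurent rings below holds without a case distinction.\<close>

definition laurent_over :: "'f::field set \<Rightarrow> 'f \<Rightarrow> 'f set" where
  "laurent_over E y = {h. \<exists>n. h * y ^ n \<in> adjoin E y}"

lemma is_subring_laurent_over:
  assumes "is_subring E"
  shows "is_subring (laurent_over E y)"
proof -
  note A = is_subring_adjoin[OF assms]
  have y: "y \<in> adjoin E y" by (rule adjoin_var[OF assms])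
  show ?thesis
    unfolding is_subring_def
  proof (intro conjI ballI)
    show "1 \<in> laurent_over E y"
      by (auto simp: laurent_over_def intro!: exI[of _ 0] subring_1[OF A])
    fix u v assume "u \<in> laurent_over E y" "v \<in> laurent_over E y"
    then obtain m n where *: "u * y ^ m \<in> adjoin E y" "v * y ^ n \<in> adjoin E y"
      by (auto simp: laurent_over_def)
    have eq: "(u - v) * y ^ (m + n) = (u * y ^ m) * y ^ n - (v * y ^ n) * y ^ m"
      "(u * v) * y ^ (m + n) = (u * y ^ m) * (v * y ^ n)"
      by (simp_all add: algebra_simps power_add)
    have "(u - v) * y ^ (m + n) \<in> adjoin E y" "(u * v) * y ^ (m + n) \<in> adjoin E y"
      unfolding eq by (intro subring_diff[OF A] subring_mult[OF A] subring_power[OF A] * y)+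
    then show "u - v \<in> laurent_over E y" "u * v \<in> laurent_over E y"
      unfolding laurent_over_def by blast+
  qed
qed

lemma laurent_over_base: "is_subring E \<Longrightarrow> c \<in> E \<Longrightarrow> c \<in> laurent_over E y"
  unfolding laurent_over_def by (auto intro!: exI[of _ 0] adjoin_base)

lemma laurent_over_var: "is_subring E \<Longrightarrow> y \<in> laurent_over E y"
  unfolding laurent_over_def by (auto intro!: exI[of _ 0] adjoin_var)

lemma laurent_over_inverse:
  assumes "is_subring E" shows "inverse y \<in> laurent_over E y"
proof (cases "y = 0")
  case True
  then show ?thesis
    by (simp add: subring_0 is_subring_laurent_over assms)
next
  case False
  then show ?thesis
    unfolding laurent_over_def using subring_1[OF is_subring_adjoin[OF assms]]
    by (auto intro!: exI[of _ 1])
qed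

lemma laurent_ring_insert_subset: "laurent_ring (insert y Y) \<subseteq> laurent_over (laurent_ring Y) y"
  by (rule laurent_ring_least)
     (auto intro: is_subring_laurent_over is_subring_laurent_ring laurent_over_base laurent_over_var
       laurent_over_inverse laurent_ring_var laurent_ring_inverse)

definition transcendental_over :: "'f::comm_ring_1 set \<Rightarrow> 'f \<Rightarrow> bool" where
  "transcendental_over E y \<longleftrightarrow> (\<forall>p\<in>polys E. poly p y = 0 \<longrightarrow> p = 0)"

lemma transcendental_eq:
  fixes y :: "'f::comm_ring_1"
  assumes "is_subring F" "transcendental_over F y" "p \<in> polys F" "q \<in> polys F" "poly p y = poly q y"
  shows "p = q"
proof -
  have "p - q \<in> polys F"
    using subring_diff[OF is_subring_polys[OF assms(1)]] assms by blast
  then show ?thesis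
    using assms(2,5) by (auto simp: transcendental_over_def)
qed

lemma transcendental_power_add_neq_0:
  assumes F: "is_subring F" "transcendental_over F y" "c \<in> F" "b > 0"
  shows "y ^ b + c \<noteq> 0"
proof
  assume eq: "y ^ b + c = 0"
  have "monom 1 b + [:c:] \<in> polys F"
    using F by (auto simp: polys_def coeff_pCons subring_0 subring_1 intro!: subring_intros split: nat.split)
  moreover have "poly (monom 1 b + [:c:]) y = 0"
    using eq by (simp add: poly_monom)
  ultimately have "monom 1 b + [:c:] = 0"
    using F by (auto simp: transcendental_over_def)
  then have "coeff (monom 1 b + [:c:]) b = 0" by simp
  then show False using \<open>b > 0\<close> by (simp add: coeff_pCons split: nat.split_asm)
qed

lemma is_subfield_subring: "is_subfield F \<Longrightarrow> is_subring F"
  by (simp add: is_subfield_def)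

lemma subfield_inverse: "is_subfield F \<Longrightarrow> u \<in> F \<Longrightarrow> inverse u \<in> F"
  by (simp add: is_subfield_def)

lemma is_subfield_generated: "is_subfield (subfield_generated S)"
  using is_subring_Inter[of "{K. is_subfield K \<and> S \<subseteq> K}"]
  by (auto simp: subfield_generated_def is_subfield_def)

lemma subfield_generated_superset: "S \<subseteq> subfield_generated S"
  unfolding subfield_generated_def by blast

lemma subfield_generated_least: "is_subfield K \<Longrightarrow> S \<subseteq> K \<Longrightarrow> subfield_generated S \<subseteq> K"
  unfolding subfield_generated_def by blast

lemma laurent_ring_subset_subfield:
  "is_subfield F \<Longrightarrow> Y \<subseteq> F \<Longrightarrow> laurent_ring Y \<subseteq> F"
  by (intro laurent_ring_least) (auto simp: is_subfield_def)

lemma transcendental_neq_0: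
  assumes "is_subring F" "transcendental_over F y" shows "y \<noteq> 0"
  using transcendental_power_add_neq_0[OF assms subring_0[OF assms(1)], of 1] by simp

text \<open>The polynomial \<open>y^(degree q) q(P / y)\<close> with denominators cleared: the
  coefficients of \<open>q\<close> in reverse order, the one of index \<open>i\<close> weighted by
  \<open>P^i\<close>.\<close>

definition scaled_reflect :: "'f::field \<Rightarrow> 'f poly \<Rightarrow> 'f poly" where
  "scaled_reflect P q = (\<Sum>i\<le>degree q. monom (coeff q i * P ^ i) (degree q - i))"

lemma coeff_scaled_reflect:
  "coeff (scaled_reflect P q) k =
     (if k \<le> degree q then coeff q (degree q - k) * P ^ (degree q - k) else 0)"
proof -
  have "coeff (scaled_reflect P q) k =
      (\<Sum>i\<le>degree q. if i = degree q - k \<and> k \<le> degree q then coeff q i * P ^ i else 0)"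
    unfolding scaled_reflect_def coeff_sum coeff_monom by (rule sum.cong) auto
  then show ?thesis by (auto simp: sum.delta)
qed

lemma poly_scaled_reflect:
  assumes "y \<noteq> 0"
  shows "poly (scaled_reflect P q) y = poly q (P / y) * y ^ degree q"
proof -
  have "poly (scaled_reflect P q) y = (\<Sum>i\<le>degree q. coeff q i * (P / y) ^ i * y ^ degree q)"
    unfolding scaled_reflect_def poly_sum poly_monom
  proof (rule sum.cong)
    fix i assume "i \<in> {..degree q}"
    then have "y ^ degree q = y ^ i * y ^ (degree q - i)" by (simp flip: power_add)
    moreover have "P ^ i = (P / y) ^ i * y ^ i"
      using assms by (simp flip: power_mult_distrib)
    ultimately show "coeff q i * P ^ i * y ^ (degree q - i) = coeff q i * (P / y) ^ i * y ^ degree q"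
      by (simp only: mult_ac)
  qed simp
  then show ?thesis
    by (simp add: poly_altdef sum_distrib_right)
qed

lemma scaled_reflect_in_polys:
  "is_subring F \<Longrightarrow> P \<in> F \<Longrightarrow> q \<in> polys F \<Longrightarrow> scaled_reflect P q \<in> polys F"
  by (auto simp: polys_def coeff_scaled_reflect intro!: subring_mult subring_power subring_0)

text \<open>A relation \<open>q\<close> for \<open>P / y\<close> becomes the relation
  \<open>scaled_reflect P q\<close> for \<open>y\<close>, whose constant coefficient is the leading
  coefficient of \<open>q\<close> times a power of \<open>P\<close>.\<close>

lemma transcendental_divide:
  fixes y :: "'f::field"
  assumes "is_subring F" "transcendental_over F y" "P \<in> F" "P \<noteq> 0"
  shows "transcendental_over F (P / y)"
  unfolding transcendental_over_def
proof (intro ballI impI)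
  fix q assume q: "q \<in> polys F" "poly q (P / y) = 0"
  have "poly (scaled_reflect P q) y = 0"
    using poly_scaled_reflect[OF transcendental_neq_0[OF assms(1,2)]] q(2) by simp
  then have "scaled_reflect P q = 0"
    using assms scaled_reflect_in_polys q(1) by (auto simp: transcendental_over_def)
  then have "coeff q (degree q) * P ^ degree q = 0"
    using coeff_scaled_reflect[of P q 0] by simp
  then show "q = 0" using assms(4) by simp
qed

text \<open>Compare the coefficients of the lowest power of \<open>y\<close> in the two expansions of \<open>h\<close>,
  and remove the corresponding power of \<open>P / y\<close>.\<close>

lemma laurent_exchange_decompose:
  fixes h :: "'f::field"
  assumes E: "is_subring E" and D: "is_subring D" and ED: "E \<subseteq> D"
    and F: "is_subring F" "D \<subseteq> F" "transcendental_over F y"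
    and P: "P \<in> E" "P \<noteq> 0"
    and sat: "\<And>e. e \<in> D \<Longrightarrow> e * P \<in> E \<Longrightarrow> e \<in> E"
    and h: "h * y ^ n \<in> adjoin E y" "h * (P / y) ^ m \<in> adjoin D (P / y)"
  shows "\<exists>g\<in>adjoin E y. \<exists>k\<in>adjoin E (P / y). h = g + k"
  using h
proof (induction n arbitrary: h)
  case 0
  then show ?case
    using subring_0[OF is_subring_adjoin[OF E, of "P / y"]] by force
next
  case (Suc n)
  have y: "y \<noteq> 0" by (rule transcendental_neq_0[OF F(1,3)])
  have EF: "E \<subseteq> F" using ED F(2) by blast
  obtain p where p: "p \<in> polys E" "h * y ^ Suc n = poly p y"
    using Suc.prems(1) by (auto simp: adjoin_def)
  obtain q where q: "q \<in> polys D" "h * (P / y) ^ m = poly q (P / y)"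
    using Suc.prems(2) by (auto simp: adjoin_def)
  define s where "s = degree q"
  define r where "r = scaled_reflect P q"
  have r: "poly r y = h * (P / y) ^ m * y ^ s"
    using poly_scaled_reflect[OF y] q(2) by (simp add: r_def s_def)
  note r_coeff = coeff_scaled_reflect[of P q, folded r_def s_def]
  have PF: "P \<in> F" using P(1) EF by blast
  have "r \<in> polys F"
    unfolding r_def using scaled_reflect_in_polys[OF F(1) PF] q(1) polys_mono[OF F(2)] by blast
  moreover have "p \<in> polys F" using p(1) EF polys_mono by blast
  ultimately have inF: "smult (P ^ m) (monom 1 s * p) \<in> polys F" "monom 1 (Suc n + m) * r \<in> polys F"
    using PF F(1) is_subring_polys[OF F(1)]
    by (auto simp: polys_def coeff_monom_mult intro!: subring_intros)
  \<comment> \<open>Both sides equal \<open>h P^m y^(n + 1 + s)\<close>. The coefficient of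
    \<open>y^s\<close> isolates \<open>coeff p 0\<close> on the left.\<close>
  have "poly (smult (P ^ m) (monom 1 s * p)) y = poly (monom 1 (Suc n + m) * r) y"
    using y by (simp add: poly_monom p(2)[symmetric] r power_divide power_add)
  then have "smult (P ^ m) (monom 1 s * p) = monom 1 (Suc n + m) * r"
    using transcendental_eq[OF F(1,3) inF] by blast
  then have "coeff (smult (P ^ m) (monom 1 s * p)) s = coeff (monom 1 (Suc n + m) * r) s"
    by simp
  then have "P ^ m * coeff p 0 = (if Suc n + m \<le> s then coeff r (s - (Suc n + m)) else 0)"
    by (simp add: coeff_monom_mult)
  also have "\<dots> = coeff q (Suc n + m) * P ^ (Suc n + m)"
    using r_coeff[of "s - (Suc n + m)"] by (auto simp: s_def coeff_eq_0)
  finally have p0: "coeff p 0 = coeff q (Suc n + m) * P ^ Suc n"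
    using P(2) by (simp add: power_add field_simps)
  define d where "d = coeff q (Suc n + m)"
  have dD: "d \<in> D" using q(1) by (simp add: d_def polys_def)
  \<comment> \<open>So far \<open>d\<close> is known to lie only in \<open>D\<close>;
    \<open>d P^(n + 1)\<close> is the coefficient \<open>coeff p 0\<close> in \<open>E\<close>, and
    saturation removes the factors \<open>P\<close> one at a time.\<close>
  have "d * P ^ k \<in> E \<Longrightarrow> d \<in> E" for k
  proof (induction k)
    case (Suc k)
    have "d * P ^ k * P \<in> E" using Suc.prems by (simp add: mult_ac)
    moreover have "d * P ^ k \<in> D"
      by (intro subring_mult[OF D] dD subring_power[OF D] subsetD[OF ED P(1)])
    ultimately show ?case
      using Suc.IH sat by blast
  qed simp
  then have dE: "d \<in> E"
    using p0 p(1) by (metis d_def polys_coeff)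
  \<comment> \<open>The lowest term \<open>coeff p 0 / y^(n + 1)\<close> of \<open>h\<close> equals
    \<open>d (P / y)^(n + 1)\<close>, so subtracting it lowers the pole order in
    \<open>y\<close>.\<close>
  define h' where "h' = h - d * (P / y) ^ Suc n"
  have "h' * y ^ n \<in> adjoin E y"
  proof -
    obtain c p' where p': "p = pCons c p'" by (cases p)
    have "y * (h' * y ^ n) = poly p y - d * P ^ Suc n"
      using y by (simp add: h'_def p(2)[symmetric] field_simps power_divide)
    also have "\<dots> = y * poly p' y"
      using p0 by (simp add: p' d_def)
    finally have "h' * y ^ n = poly p' y" using y by simp
    moreover have "p' \<in> polys E" using p(1) by (simp add: p' polys_pCons)
    ultimately show ?thesis by (auto simp: adjoin_def)
  qed
  moreover have "h' * (P / y) ^ m \<in> adjoin D (P / y)"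
  proof -
    have eq: "h' * (P / y) ^ m = h * (P / y) ^ m - d * (P / y) ^ (Suc n + m)"
      by (simp add: h'_def algebra_simps power_add)
    note A = is_subring_adjoin[OF D, of "P / y"]
    show ?thesis
      unfolding eq
      by (intro subring_diff[OF A] subring_mult[OF A] subring_power[OF A] Suc.prems(2)
          adjoin_base[OF D dD] adjoin_var[OF D])
  qed
  ultimately obtain g k where gk: "g \<in> adjoin E y" "k \<in> adjoin E (P / y)" "h' = g + k"
    using Suc.IH by blast
  have "h = g + (k + d * (P / y) ^ Suc n)"
    using gk(3) by (simp add: h'_def algebra_simps)
  moreover have "k + d * (P / y) ^ Suc n \<in> adjoin E (P / y)"
    using is_subring_adjoin[OF E, of "P / y"] gk(2) adjoin_base[OF E dE] adjoin_var[OF E]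
    by (intro subring_add subring_mult subring_power)
  ultimately show ?case using gk(1) by blast
qed

text \<open>The case \<open>D = E\<close> of the decomposition, where saturation is trivial: over
  \<open>L = laurent_ring Y\<close>, an element of both Laurent rings splits into a part in
  \<open>L[u]\<close> and a part in \<open>L[P / u]\<close>.\<close>

lemma laurent_exchange:
  fixes u P :: "'f::field"
  assumes F: "is_subfield F" "Y \<subseteq> F" "transcendental_over F u"
    and P: "P \<in> laurent_ring Y" "P \<noteq> 0"
    and f: "f \<in> laurent_ring (insert u Y)" "f \<in> laurent_ring (insert (P / u) Y)"
  shows "\<exists>g\<in>adjoin (laurent_ring Y) u. \<exists>k\<in>adjoin (laurent_ring Y) (P / u). f = g + k"
proof -
  obtain n m where "f * u ^ n \<in> adjoin (laurent_ring Y) u"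
      "f * (P / u) ^ m \<in> adjoin (laurent_ring Y) (P / u)"
    using f laurent_ring_insert_subset unfolding laurent_over_def by blast
  then show ?thesis
    using laurent_exchange_decompose[of "laurent_ring Y" "laurent_ring Y" F u P f n m]
      F P laurent_ring_subset_subfield[OF F(1,2)] is_subfield_subring[OF F(1)] is_subring_laurent_ring
    by blast
qed

text \<open>The idea of the upper bound theorem of Berenstein, Fomin and Zelevinsky in rank two: the
  intersection of the first three Laurent rings is contained in the ring generated by
  \<open>u, u', v, v'\<close> and \<open>w, w\<inverse>\<close>, which does not see the mutation at \<open>u\<close>.\<close>

lemma laurent_exchange_step:
  fixes u v w :: "'f::field"
  assumes tu: "transcendental_over (subfield_generated {v, w}) u"
    and tv: "transcendental_over (subfield_generated {u, w}) v"
    and w0: "w \<noteq> 0"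
    and b: "b > 0" and de: "d + e = b * c"
    and u': "u' = (v ^ b + w ^ c) / u"
    and v': "v' = (u ^ b + w ^ d) / v"
    and v'': "v'' = (u' ^ b + w ^ e) / v"
    and f: "f \<in> laurent_ring {u, v, w}" "f \<in> laurent_ring {u', v, w}" "f \<in> laurent_ring {u, v', w}"
  shows "f \<in> laurent_ring {u', v'', w}"
proof -
  define Fu where "Fu = subfield_generated {v, w}"
  define Fv where "Fv = subfield_generated {u, w}"
  have Fu: "is_subfield Fu" "{v, w} \<subseteq> Fu" and Fv: "is_subfield Fv" "{u, w} \<subseteq> Fv"
    unfolding Fu_def Fv_def by (rule is_subfield_generated subfield_generated_superset)+
  note Fu_ring = is_subfield_subring[OF Fu(1)] and Fv_ring = is_subfield_subring[OF Fv(1)]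
  note tu' = tu[folded Fu_def] and tv' = tv[folded Fv_def]
  have u0: "u \<noteq> 0" by (rule transcendental_neq_0[OF Fu_ring tu'])
  have v0: "v \<noteq> 0" by (rule transcendental_neq_0[OF Fv_ring tv'])
  have P0: "v ^ b + w ^ c \<noteq> 0"
    using Fv by (intro transcendental_power_add_neq_0[OF Fv_ring tv' _ b] subring_power[OF Fv_ring]) auto
  have Q0: "u ^ b + w ^ d \<noteq> 0"
    using Fu by (intro transcendental_power_add_neq_0[OF Fu_ring tu' _ b] subring_power[OF Fu_ring]) auto
  have R0: "u' ^ b + w ^ e \<noteq> 0"
  proof
    assume "u' ^ b + w ^ e = 0"
    \<comment> \<open>Multiplying by \<open>u^b / w^e\<close> turns the equation into a monic
      relation for \<open>u\<close> over the field generated by \<open>v\<close> and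
      \<open>w\<close>.\<close>
    then have "u ^ b + (v ^ b + w ^ c) ^ b * inverse (w ^ e) = 0"
      using u0 w0 by (simp add: u' power_divide field_simps)
    moreover have "(v ^ b + w ^ c) ^ b * inverse (w ^ e) \<in> Fu"
      using Fu(2) by (intro subring_mult[OF Fu_ring] subring_power[OF Fu_ring] subring_add[OF Fu_ring]
        subfield_inverse[OF Fu(1)]) auto
    ultimately show False
      using transcendental_power_add_neq_0[OF Fu_ring tu' _ b] by blast
  qed
  have u'0: "u' \<noteq> 0" and v'0: "v' \<noteq> 0" and v''0: "v'' \<noteq> 0"
    using u0 v0 P0 Q0 R0 by (auto simp: u' v' v'')
  define R where "R = laurent_ring {u', v'', w}"
  have R: "is_subring R" unfolding R_def by (rule is_subring_laurent_ring)
  note R_intros = subring_add[OF R] subring_diff[OF R] subring_mult[OF R] subring_power[OF R]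
    subring_sum[OF R]
  have R_vars: "u' \<in> R" "inverse u' \<in> R" "v'' \<in> R" "inverse v'' \<in> R" "w \<in> R" "inverse w \<in> R"
    unfolding R_def by (auto intro: laurent_ring_var laurent_ring_inverse)
  have "v = (u' ^ b + w ^ e) * inverse v''"
    using v0 v''0 R0 by (simp add: v'' field_simps)
  then have vR: "v \<in> R" using R_vars R_intros by metis
  have "u = (v ^ b + w ^ c) * inverse u'"
    using u0 u'0 P0 by (simp add: u' field_simps)
  then have uR: "u \<in> R" using R_vars vR R_intros by metis
  have v'R: "v' \<in> R"
  proof -
    \<comment> \<open>\<open>u'^b v v' = (v^b + w^c)^b + w^d u'^b\<close>. By
      \<open>d + e = b c\<close> this is
      \<open>((v^b + w^c)^b - w^(b c)) + w^d (u'^b + w^e)\<close>. The first summand is divisible by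
      \<open>v\<close>, the second is \<open>w^d v v''\<close>; dividing by \<open>u'^b v\<close>
      gives \<open>v' = t + w^d v'' / u'^b\<close>.\<close>
    define t where "t = inverse u' ^ b * v ^ (b - 1) *
      (\<Sum>i<b. (w ^ c) ^ (b - Suc i) * (v ^ b + w ^ c) ^ i)"
    have tR: "t \<in> R"
      unfolding t_def by (intro R_intros R_vars vR)
    have "(v ^ b + w ^ c) ^ b - (w ^ c) ^ b = v ^ b * (\<Sum>i<b. (w ^ c) ^ (b - Suc i) * (v ^ b + w ^ c) ^ i)"
      by (subst power_diff_sumr2) simp
    moreover have "v ^ b = v * v ^ (b - 1)"
      using b by (cases b) auto
    ultimately have "v * t = inverse u' ^ b * ((v ^ b + w ^ c) ^ b - (w ^ c) ^ b)"
      by (simp add: t_def mult_ac)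
    also have "\<dots> = u ^ b - w ^ d * w ^ e * inverse u' ^ b"
    proof -
      have "inverse u' ^ b * (v ^ b + w ^ c) ^ b = u ^ b"
        using u0 P0 by (simp add: u' flip: power_mult_distrib)
      moreover have "(w ^ c) ^ b = w ^ d * w ^ e"
        using de by (simp flip: power_mult power_add add: mult.commute)
      ultimately show ?thesis by (simp add: algebra_simps)
    qed
    finally have vt: "v * t = u ^ b - w ^ d * w ^ e * inverse u' ^ b" .
    have "v * v'' = u' ^ b + w ^ e" "v * v' = u ^ b + w ^ d" using v0 by (simp_all add: v' v'')
    moreover have "inverse u' ^ b * u' ^ b = 1"
      using u'0 by (simp flip: power_mult_distrib)
    moreover have "v * (t + w ^ d * inverse u' ^ b * v'') = v * t + w ^ d * inverse u' ^ b * (v * v'')"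
      by (simp add: algebra_simps)
    ultimately have "v * (t + w ^ d * inverse u' ^ b * v'') = v * v'"
      using vt by (simp add: algebra_simps)
    then have "v' = t + w ^ d * inverse u' ^ b * v''" using v0 by simp
    then show ?thesis using tR R_vars R_intros by metis
  qed
  \<comment> \<open>With \<open>E = Z[w, 1/w, u]\<close>, the rings are \<open>B = E[v]\<close>,
    \<open>H = E[v, 1/v]\<close> and \<open>A = B[u', v']\<close>. The aim is
    \<open>f = g + h\<close> with \<open>g\<close> in \<open>A\<close> and \<open>h\<close> in
    \<open>H\<close>: then only \<open>h\<close> is left to decompose, this time in the direction
    \<open>v\<close>.\<close>
  define E where "E = adjoin (laurent_ring {w}) u"
  have E: "is_subring E" unfolding E_def by (intro is_subring_adjoin is_subring_laurent_ring)
  have uE: "u \<in> E" unfolding E_def by (rule adjoin_var[OF is_subring_laurent_ring])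
  have LE: "laurent_ring {w} \<subseteq> E"
    unfolding E_def by (auto intro: adjoin_base[OF is_subring_laurent_ring])
  have wE: "w \<in> E" "inverse w \<in> E"
    using LE laurent_ring_var[of w "{w}"] laurent_ring_inverse[of w "{w}"] by auto
  define B where "B = adjoin E v"
  have B: "is_subring B" unfolding B_def by (rule is_subring_adjoin[OF E])
  define H where "H = laurent_over E v"
  have H: "is_subring H" unfolding H_def by (rule is_subring_laurent_over[OF E])
  have EH: "E \<subseteq> H" unfolding H_def by (auto intro: laurent_over_base[OF E])
  have vH: "v \<in> H" "inverse v \<in> H"
    unfolding H_def by (rule laurent_over_var[OF E], rule laurent_over_inverse[OF E])
  have v'H: "v' \<in> H"
    unfolding v' divide_inverse using EH uE wE vH
    by (intro subring_mult[OF H] subring_add[OF H] subring_power[OF H]) auto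
  have BH: "B \<subseteq> H" unfolding B_def by (rule adjoin_least[OF H EH vH(1)])
  define A where "A = subring_generated (B \<union> {u', v'})"
  have A: "is_subring A" unfolding A_def by (rule is_subring_generated)
  have BA: "B \<subseteq> A" "u' \<in> A" "v' \<in> A"
    unfolding A_def using subring_generated_superset[of "B \<union> {u', v'}"] by auto
  have EB: "E \<subseteq> B" "v \<in> B" unfolding B_def by (auto intro: adjoin_base[OF E] adjoin_var[OF E])
  define T where "T = {g + h | g h. g \<in> A \<and> h \<in> H}"
  have AT: "A \<subseteq> T" unfolding T_def using subring_0[OF H] by force
  have HT: "H \<subseteq> T" unfolding T_def using subring_0[OF A] by force
  have T_add: "s + t \<in> T" if "s \<in> T" "t \<in> T" for s t
  proof -
    obtain g h g' h' where "s = g + h" "t = g' + h'" "g \<in> A" "h \<in> H" "g' \<in> A" "h' \<in> H"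
      using \<open>s \<in> T\<close> \<open>t \<in> T\<close> unfolding T_def by blast
    moreover from this have "s + t = (g + g') + (h + h')" by simp
    ultimately show ?thesis unfolding T_def using subring_add[OF A] subring_add[OF H] by blast
  qed
  have T_mult: "r * s \<in> T" if "r \<in> A" "r \<in> H" "s \<in> T" for r s
  proof -
    obtain g h where "s = g + h" "g \<in> A" "h \<in> H"
      using \<open>s \<in> T\<close> unfolding T_def by blast
    moreover from this have "r * s = r * g + r * h" by (simp add: algebra_simps)
    ultimately show ?thesis unfolding T_def using subring_mult[OF A] subring_mult[OF H] that by blast
  qed
  \<comment> \<open>Products of powers of \<open>u'\<close> with elements of \<open>H\<close> must
    be moved into \<open>A + H\<close>. The induction is on the power of \<open>u'\<close> and,
    inside, on the pole order in \<open>v\<close>.\<close>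
  have T_pow: "u' ^ j * h \<in> T" if "h * v ^ n \<in> B" for j n h
    using that
  proof (induction j arbitrary: h n)
    case 0
    then show ?case using HT by (auto simp: H_def laurent_over_def B_def)
  next
    case (Suc j)
    note outer = Suc.IH
    show ?case
      using Suc.prems
    proof (induction n arbitrary: h)
      case 0
      then have "u' ^ Suc j * h \<in> A"
        using BA by (intro subring_mult[OF A] subring_power[OF A]) auto
      then show ?case using AT by blast
    next
      case (Suc n)
      have s1: "u' ^ Suc j * (h * v) \<in> T"
        using Suc by (intro Suc.IH) (simp add: mult_ac)
      have s2: "u' ^ j * h \<in> T"
        by (rule outer[OF Suc.prems])
      \<comment> \<open>Since \<open>w^d = v' v - u^b\<close> and \<open>u u' = v^b + w^c\<close>,
        the product \<open>u'^(j + 1) h\<close> is a combination of \<open>u'^(j + 1) (h v)\<close>,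
        with smaller pole order, and \<open>u'^j h\<close>, with a smaller power of
        \<open>u'\<close>. The multipliers \<open>r1\<close> and \<open>r2\<close> lie in both
        \<open>A\<close> and \<open>H\<close>, so they preserve \<open>T\<close>.\<close>
      define r1 where "r1 = inverse w ^ d * v'"
      define r2 where "r2 = - (inverse w ^ d * u ^ (b - 1) * (v ^ b + w ^ c))"
      have "r1 \<in> A" "r1 \<in> H"
        unfolding r1_def using BA EB wE EH v'H
        by (auto intro!: subring_mult[OF A] subring_power[OF A] subring_mult[OF H] subring_power[OF H])
      moreover have "r2 \<in> B"
        unfolding r2_def using EB wE uE
        by (intro subring_uminus[OF B] subring_mult[OF B] subring_power[OF B] subring_add[OF B]) auto
      ultimately have "r1 * (u' ^ Suc j * (h * v)) + r2 * (u' ^ j * h) \<in> T"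
        using s1 s2 BA(1) BH by (meson T_add T_mult subsetD)
      moreover have "r1 * (u' ^ Suc j * (h * v)) + r2 * (u' ^ j * h) = u' ^ Suc j * h"
      proof -
        have "v ^ b + w ^ c = u * u'" using u0 by (simp add: u')
        moreover have "u ^ b = u ^ (b - 1) * u" using b by (cases b) auto
        ultimately have "r2 * (u' ^ j * h) = - (inverse w ^ d * u ^ b * (u' ^ Suc j * h))"
          by (simp add: r2_def)
        moreover have "r1 * (u' ^ Suc j * (h * v)) = inverse w ^ d * (v' * v) * (u' ^ Suc j * h)"
          by (simp add: r1_def)
        moreover have "v' * v = u ^ b + w ^ d" using v0 by (simp add: v')
        ultimately have "r1 * (u' ^ Suc j * (h * v)) + r2 * (u' ^ j * h)
            = (inverse w ^ d * w ^ d) * (u' ^ Suc j * h)"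
          by (simp only:) (simp add: algebra_simps)
        moreover have "inverse w ^ d * w ^ d = 1" using w0 by (simp flip: power_mult_distrib)
        ultimately show ?thesis by simp
      qed
      ultimately show ?case by simp
    qed
  qed
  have LvH: "laurent_ring {v, w} \<subseteq> H"
    using laurent_ring_insert_subset[of v "{w}"] by (intro laurent_ring_least H) (use EH wE vH in auto)
  obtain g0 k0 where gk0: "g0 \<in> adjoin (laurent_ring {v, w}) u" "k0 \<in> adjoin (laurent_ring {v, w}) u'"
      "f = g0 + k0"
  proof -
    have "v ^ b + w ^ c \<in> laurent_ring {v, w}"
      by (intro laurent_ring_intros laurent_ring_var) auto
    then show ?thesis
      using laurent_exchange[OF Fu tu' _ P0] f(1,2) that unfolding u' by blast
  qed
  have "g0 \<in> H"
    using adjoin_least[OF H LvH subsetD[OF EH uE]] gk0(1) by blast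
  moreover have "k0 \<in> T"
  proof -
    obtain p where p: "p \<in> polys (laurent_ring {v, w})" "k0 = poly p u'"
      using gk0(2) by (auto simp: adjoin_def)
    have "u' ^ i * coeff p i \<in> T" for i
    proof -
      have "coeff p i \<in> H" using p(1) LvH by (auto simp: polys_def)
      then show ?thesis using T_pow by (auto simp: H_def laurent_over_def B_def)
    qed
    then have "(\<Sum>i\<in>I. u' ^ i * coeff p i) \<in> T" for I
      using HT subring_0[OF H] by (induction I rule: infinite_finite_induct) (auto intro: T_add)
    then show ?thesis by (simp add: p(2) poly_altdef mult.commute)
  qed
  ultimately have "f \<in> T" unfolding gk0(3) using HT T_add by blast
  then obtain g h where gh: "f = g + h" "g \<in> A" "h \<in> H" unfolding T_def by blast
  \<comment> \<open>As \<open>A\<close> is contained in \<open>laurent_ring {u, v', w}\<close>, the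
    hypothesis on \<open>f\<close> passes to \<open>h = f - g\<close>. It provides coefficients in
    which \<open>u\<close> is inverted, whereas \<open>h\<close> in \<open>H\<close> has
    coefficients in \<open>E\<close>; hence the decomposition with \<open>D\<close> larger than
    \<open>E\<close>.\<close>
  define R2 where "R2 = laurent_ring {u, v', w}"
  have R2: "is_subring R2" unfolding R2_def by (rule is_subring_laurent_ring)
  have R2_vars: "u \<in> R2" "inverse u \<in> R2" "v' \<in> R2" "inverse v' \<in> R2" "w \<in> R2" "inverse w \<in> R2"
    unfolding R2_def by (auto intro: laurent_ring_var laurent_ring_inverse)
  note R2_intros = subring_add[OF R2] subring_mult[OF R2] subring_power[OF R2]
  have "v = (u ^ b + w ^ d) * inverse v'"
    using v0 v'0 Q0 by (simp add: v' field_simps)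
  then have vR2: "v \<in> R2" using R2_vars R2_intros by metis
  have "u' = (v ^ b + w ^ c) * inverse u" by (simp add: u' divide_inverse)
  then have u'R2: "u' \<in> R2" using R2_vars R2_intros vR2 by metis
  have ER2: "E \<subseteq> R2"
    unfolding E_def by (intro adjoin_least[OF R2] laurent_ring_least[OF R2]) (use R2_vars in auto)
  have "A \<subseteq> R2"
    unfolding A_def B_def using adjoin_least[OF R2 ER2 vR2] u'R2 R2_vars
    by (intro subring_generated_least[OF R2]) auto
  then have "f - g \<in> R2"
    using subring_diff[OF R2] f(3) gh(2) unfolding R2_def by blast
  then have hR2: "h \<in> laurent_ring (insert v' {u, w})"
    using gh(1) by (simp add: R2_def insert_commute)
  have ER: "E \<subseteq> R"
    unfolding E_def by (intro adjoin_least[OF R] laurent_ring_least[OF R]) (use R_vars uR in auto)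
  obtain n m where nm: "h * v ^ n \<in> adjoin E v"
      "h * ((u ^ b + w ^ d) / v) ^ m \<in> adjoin (laurent_ring {u, w}) ((u ^ b + w ^ d) / v)"
    using gh(3) hR2 laurent_ring_insert_subset[of v' "{u, w}"]
    unfolding H_def laurent_over_def v' by blast
  have "\<exists>g\<in>adjoin E v. \<exists>k\<in>adjoin E ((u ^ b + w ^ d) / v). h = g + k"
  proof (rule laurent_exchange_decompose[OF E is_subring_laurent_ring _ Fv_ring _ tv' _ Q0 _ nm])
    show "E \<subseteq> laurent_ring {u, w}"
      unfolding E_def
      by (intro adjoin_least[OF is_subring_laurent_ring] laurent_ring_mono laurent_ring_var) auto
    show "laurent_ring {u, w} \<subseteq> Fv" by (rule laurent_ring_subset_subfield[OF Fv])
    show PE: "u ^ b + w ^ d \<in> E"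
      by (intro subring_add[OF E] subring_power[OF E] uE wE)
    \<comment> \<open>Saturation: modulo \<open>u\<close> the polynomial \<open>u^b + w^d\<close> is
      the unit \<open>w^d\<close>, so a denominator \<open>u\<close> of \<open>x\<close> would
      survive multiplication by it. Powers of \<open>u\<close> are removed one at a time.\<close>
    fix x assume x: "x \<in> laurent_ring {u, w}" "x * (u ^ b + w ^ d) \<in> E"
    obtain n where "x * u ^ n \<in> E"
      using x(1) laurent_ring_insert_subset[of u "{w}"] unfolding laurent_over_def E_def by blast
    then show "x \<in> E"
    proof (induction n)
      case (Suc n)
      define z where "z = x * u ^ n"
      have zu: "z * u \<in> E" using Suc.prems by (simp add: z_def mult_ac)
      have "z * (u ^ b + w ^ d) = u ^ n * (x * (u ^ b + w ^ d))" by (simp add: z_def mult_ac)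
      then have zP: "z * (u ^ b + w ^ d) \<in> E"
        using subring_mult[OF E subring_power[OF E uE] x(2)] by metis
      have "u * u ^ (b - 1) = u ^ b" using b by (cases b) auto
      then have "z = inverse w ^ d * (z * (u ^ b + w ^ d) - z * u * u ^ (b - 1))"
        using w0 by (simp add: algebra_simps power_inverse)
      also have "\<dots> \<in> E"
        by (intro subring_mult[OF E] subring_power[OF E] subring_diff[OF E] uE wE zu zP)
      finally show ?case using Suc.IH by (simp add: z_def)
    qed simp
  qed
  then obtain g1 k1 where "g1 \<in> adjoin E v" "k1 \<in> adjoin E v'" "h = g1 + k1"
    unfolding v' by blast
  moreover have "adjoin E v \<subseteq> R" "adjoin E v' \<subseteq> R"
    by (rule adjoin_least[OF R ER]; rule vR v'R)+
  moreover from this have "A \<subseteq> R"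
    unfolding A_def B_def using R_vars v'R by (intro subring_generated_least[OF R]) auto
  ultimately show ?thesis
    using gh subring_add[OF R] unfolding R_def by blast
qed

section \<open>The upper bound\<close>

text \<open>Coefficients range over subfields, so that Laurent polynomials in the other two
  variables are admissible. Listing all three conditions lets a fact about \<open>u\<close> pass to
  \<open>v\<close> and \<open>w\<close> by rotation.\<close>

definition independent3 :: "'f::field \<Rightarrow> 'f \<Rightarrow> 'f \<Rightarrow> bool" where
  "independent3 u v w \<longleftrightarrow>
     transcendental_over (subfield_generated {v, w}) u \<and>
     transcendental_over (subfield_generated {u, w}) v \<and>
     transcendental_over (subfield_generated {u, v}) w"

lemma independent3_rotate: "independent3 u v w \<Longrightarrow> independent3 v w u"
  by (auto simp: independent3_def insert_commute)

lemma independent3_neq_0: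
  assumes "independent3 u v w" shows "u \<noteq> 0" "v \<noteq> 0" "w \<noteq> 0"
  using assms unfolding independent3_def
  by (meson transcendental_neq_0 is_subfield_subring is_subfield_generated)+

lemma independent3_power_sum_neq_0:
  assumes "independent3 u v w" "b > 0" shows "u ^ b + v ^ c \<noteq> 0"
proof -
  note F = is_subfield_subring[OF is_subfield_generated, of "{v, w}"]
  have "v ^ c \<in> subfield_generated {v, w}"
    using subfield_generated_superset[of "{v, w}"] by (intro subring_power[OF F]) auto
  then show ?thesis
    using assms by (intro transcendental_power_add_neq_0[OF F]) (auto simp: independent3_def)
qed

section \<open>Divisibility in \<open>Z[u, v, w]\<close>\<close>

lemma subring_generated_subset_subfield:
  "S \<subseteq> T \<Longrightarrow> subring_generated S \<subseteq> subfield_generated T"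
  using subfield_generated_superset[of T]
  by (intro subring_generated_least is_subfield_subring is_subfield_generated) auto

lemma transcendental_const_eq_0:
  assumes "is_subring E" "E \<subseteq> F" "transcendental_over F y"
    and "c \<in> E" "s \<in> adjoin E y" "c = y * s"
  shows "c = 0"
proof -
  obtain p where p: "p \<in> polys E" "s = poly p y"
    using assms(5) by (auto simp: adjoin_def)
  have "pCons (- c) p \<in> polys F"
    using p(1) subring_uminus[OF assms(1,4)] polys_mono[OF assms(2)] assms(2)
    by (auto simp: polys_pCons)
  moreover have "poly (pCons (- c) p) y = 0"
    using assms(6) p(2) by simp
  ultimately have "pCons (- c) p = 0"
    using assms(3) by (auto simp: transcendental_over_def)
  then show ?thesis by simp
qed

text \<open>Compare constant terms in \<open>y\<close>: the factor reduces to \<open>e\<close>,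
  which is nonzero in a domain, so the constant term of \<open>d\<close> vanishes.\<close>

lemma transcendental_prime:
  fixes y :: "'f::field"
  assumes E: "is_subring E" "E \<subseteq> F" "transcendental_over F y"
    and e: "e \<in> E" "e \<noteq> 0" and g': "g' \<in> adjoin E y"
    and d: "d \<in> adjoin E y" "r \<in> adjoin E y" "(e + y * g') * d = y * r"
  shows "\<exists>d'\<in>adjoin E y. d = y * d'"
proof -
  note A = is_subring_adjoin[OF E(1), of y]
  obtain c d' where d': "c \<in> E" "d' \<in> adjoin E y" "d = c + y * d'"
    using adjoinE[OF d(1)] .
  have "e * c = y * (r - g' * d - e * d')"
    using d(3) by (simp add: d'(3) algebra_simps)
  moreover have "r - g' * d - e * d' \<in> adjoin E y"
    by (intro subring_diff[OF A] subring_mult[OF A] d g' d' adjoin_base[OF E(1) e(1)])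
  ultimately have "e * c = 0"
    using transcendental_const_eq_0[OF E] subring_mult[OF E(1) e(1) d'(1)] by blast
  then have "c = 0" using e(2) by simp
  then show ?thesis using d' by auto
qed

text \<open>Modulo \<open>u\<close> the numerator of \<open>M\<close> is \<open>v^a + w^a\<close>,
  which is nonzero.\<close>

lemma independent3_dvd_cancel:
  assumes i: "independent3 u v w" and a: "a > 0"
    and d: "d \<in> subring_generated {u, v, w}" "r \<in> subring_generated {u, v, w}"
    and eq: "(u ^ a + v ^ a + w ^ a) * d = u * r"
  shows "\<exists>d'\<in>subring_generated {u, v, w}. d = u * d'"
proof -
  let ?E = "subring_generated {v, w}"
  note E = is_subring_generated[of "{v, w}"]
  have vw: "v \<in> ?E" "w \<in> ?E" using subring_generated_superset[of "{v, w}"] by auto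
  note D = subring_generated_insert[of u "{v, w}"]
  have e0: "v ^ a + w ^ a \<noteq> 0"
    by (rule independent3_power_sum_neq_0[OF independent3_rotate[OF i] a])
  have g: "u ^ (a - 1) \<in> adjoin ?E u"
    by (intro subring_power[OF is_subring_adjoin[OF E]] adjoin_var[OF E])
  have "u ^ a + v ^ a + w ^ a = v ^ a + w ^ a + u * u ^ (a - 1)"
    using a by (cases a) auto
  then have "(v ^ a + w ^ a + u * u ^ (a - 1)) * d = u * r"
    using eq by metis
  moreover have "transcendental_over (subfield_generated {v, w}) u"
    using i by (simp add: independent3_def)
  moreover have "v ^ a + w ^ a \<in> ?E" by (intro subring_add[OF E] subring_power[OF E] vw)
  ultimately show ?thesis
    using transcendental_prime[OF E subring_generated_subset_subfield[OF order_refl], of u "v ^ a + w ^ a" "u ^ (a - 1)" d r]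
      d e0 g unfolding D by blast
qed

lemma independent3_dvd_cancel2:
  assumes i: "independent3 u v w"
    and d: "d \<in> subring_generated {u, v, w}" "r \<in> subring_generated {u, v, w}"
    and eq: "v * d = u * r"
  shows "\<exists>d'\<in>subring_generated {u, v, w}. d = u * d'"
proof -
  let ?E = "subring_generated {v, w}"
  note E = is_subring_generated[of "{v, w}"]
  have vw: "v \<in> ?E" "w \<in> ?E" using subring_generated_superset[of "{v, w}"] by auto
  show ?thesis
    using transcendental_prime[OF E subring_generated_subset_subfield[OF order_refl], of u v 0 d r]
      i vw d eq independent3_neq_0[OF i] subring_0[OF is_subring_adjoin[OF E]]
    unfolding subring_generated_insert[of u "{v, w}"]
    by (auto simp: independent3_def)
qed

text \<open>The quotient of \<open>Z[u, v, w]\<close> by \<open>u\<close> and \<open>v\<close> is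
  the domain \<open>Z[w]\<close>, in which \<open>w^a\<close> can be cancelled. The proof takes
  constant terms first in \<open>u\<close>, then in \<open>v\<close>.\<close>

lemma independent3_prime_ideal:
  assumes i: "independent3 u v w"
    and x: "x \<in> subring_generated {u, v, w}" "s \<in> subring_generated {u, v, w}"
      "t \<in> subring_generated {u, v, w}" "w ^ a * x = u * s + v * t"
  shows "\<exists>s'\<in>subring_generated {u, v, w}. \<exists>t'\<in>subring_generated {u, v, w}. x = u * s' + v * t'"
proof -
  let ?E1 = "subring_generated {w}" and ?E2 = "subring_generated {v, w}"
  let ?D = "subring_generated {u, v, w}"
  note E1 = is_subring_generated[of "{w}"] and E2 = is_subring_generated[of "{v, w}"]
    and D = is_subring_generated[of "{u, v, w}"]
  have E2_eq: "?E2 = adjoin ?E1 v" and D_eq: "?D = adjoin ?E2 u"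
    by (rule subring_generated_insert)+
  have w1: "w \<in> ?E1" using subring_generated_superset[of "{w}"] by auto
  have vw2: "v \<in> ?E2" "w \<in> ?E2" using subring_generated_superset[of "{v, w}"] by auto
  have E12: "?E1 \<subseteq> ?E2" and E2D: "?E2 \<subseteq> ?D" by (rule subring_generated_mono; auto)+
  obtain x0 x1 where x0: "x0 \<in> ?E2" "x1 \<in> ?D" "x = x0 + u * x1"
    using adjoinE x(1) unfolding D_eq by metis
  obtain x00 x01 where x00: "x00 \<in> ?E1" "x01 \<in> ?E2" "x0 = x00 + v * x01"
    using adjoinE x0(1) unfolding E2_eq by metis
  obtain t0 t1 where t0: "t0 \<in> ?E2" "t1 \<in> ?D" "t = t0 + u * t1"
    using adjoinE x(3) unfolding D_eq by metis
  have vwD: "v \<in> ?D" "w \<in> ?D" using vw2 E2D by auto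
  have "w ^ a * x00 + v * (w ^ a * x01 - t0) = u * (s + v * t1 - w ^ a * x1)"
    using x(4) by (simp add: x0(3) x00(3) t0(3) algebra_simps)
  moreover have "w ^ a * x00 + v * (w ^ a * x01 - t0) \<in> ?E2"
    by (intro subring_add[OF E2] subring_mult[OF E2] subring_diff[OF E2] subring_power[OF E2] vw2 t0
        x00 subsetD[OF E12 x00(1)])
  moreover have "s + v * t1 - w ^ a * x1 \<in> adjoin ?E2 u"
    unfolding D_eq[symmetric]
    by (intro subring_add[OF D] subring_mult[OF D] subring_diff[OF D] subring_power[OF D] vwD t0 x0 x)
  ultimately have "w ^ a * x00 + v * (w ^ a * x01 - t0) = 0"
    using transcendental_const_eq_0[OF E2 subring_generated_subset_subfield[OF order_refl]] i
    unfolding independent3_def by blast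
  then have "w ^ a * x00 = v * (t0 - w ^ a * x01)" by (simp add: algebra_simps eq_neg_iff_add_eq_0)
  moreover have "w ^ a * x00 \<in> ?E1"
    by (intro subring_mult[OF E1] subring_power[OF E1] w1 x00)
  moreover have "t0 - w ^ a * x01 \<in> adjoin ?E1 v"
    unfolding E2_eq[symmetric]
    by (intro subring_mult[OF E2] subring_diff[OF E2] subring_power[OF E2] vw2 t0 x00)
  ultimately have "w ^ a * x00 = 0"
    using transcendental_const_eq_0[OF E1 subring_generated_subset_subfield[of "{w}" "{u, w}"]] i
    unfolding independent3_def by blast
  then have "x = u * x1 + v * x01"
    using independent3_neq_0[OF i] by (simp add: x0(3) x00(3))
  then show ?thesis using x0(2) x00(2) E2D by blast
qed

text \<open>Gauss's lemma by descent on the degree: \<open>cop\<close> says that \<open>N\<close> is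
  cancellable modulo \<open>m\<close>, which forces \<open>m\<close> to divide the leading
  coefficient of \<open>p\<close>; a multiple of \<open>[:- N, m:]\<close> then removes the leading
  term.\<close>

lemma linear_factor_coprime:
  fixes m N :: "'f::field"
  assumes D: "is_subring D" "m \<in> D" "N \<in> D" "m \<noteq> 0"
    and cop: "\<And>d r. d \<in> D \<Longrightarrow> r \<in> D \<Longrightarrow> N * d = m * r \<Longrightarrow> \<exists>r'\<in>D. d = m * r'"
    and p: "p \<in> polys D" "poly p (N / m) = 0"
  shows "\<exists>q\<in>polys D. p = [:- N, m:] * q"
  using p
proof (induction "degree p" arbitrary: p rule: less_induct)
  case less
  note polys_ring = is_subring_polys[OF D(1)]
  show ?case
  proof (cases "degree p")
    case 0
    then obtain c where "p = [:c:]" by (rule degree_eq_zeroE)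
    then have "p = [:- N, m:] * 0" using less.prems by simp
    then show ?thesis using subring_0[OF polys_ring] by blast
  next
    case (Suc n)
    have cD: "coeff p i \<in> D" for i using less.prems(1) by (simp add: polys_def)
    have dvd_pow: "c \<in> D \<Longrightarrow> s \<in> D \<Longrightarrow> N ^ k * c = m * s \<Longrightarrow> \<exists>r'\<in>D. c = m * r'" for k c s
    proof (induction k arbitrary: s)
      case (Suc k)
      have "N * (N ^ k * c) = m * s" using Suc.prems by (simp add: mult_ac)
      then obtain r' where "r' \<in> D" "N ^ k * c = m * r'"
        using cop[of "N ^ k * c" s] Suc.prems D(3) subring_mult[OF D(1)] subring_power[OF D(1)] by blast
      then show ?case using Suc.IH Suc.prems by blast
    qed auto
    \<comment> \<open>Clear denominators with \<open>m^(n + 1)\<close>: every term except the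
      leading one keeps a factor \<open>m\<close>.\<close>
    have "0 = m ^ Suc n * poly p (N / m)" using less.prems by simp
    also have "\<dots> = (\<Sum>i\<le>Suc n. m ^ Suc n * (coeff p i * (N / m) ^ i))"
      by (simp only: poly_altdef sum_distrib_left Suc)
    also have "\<dots> = (\<Sum>i\<le>Suc n. coeff p i * N ^ i * m ^ (Suc n - i))"
    proof (rule sum.cong)
      fix i assume "i \<in> {..Suc n}"
      then have "m ^ Suc n = m ^ (Suc n - i) * m ^ i" by (simp flip: power_add)
      moreover have "N ^ i = m ^ i * (N / m) ^ i" using D(4) by (simp flip: power_mult_distrib)
      ultimately show "m ^ Suc n * (coeff p i * (N / m) ^ i) = coeff p i * N ^ i * m ^ (Suc n - i)"
        by (simp only: mult_ac)
    qed simp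
    also have "\<dots> = (\<Sum>i\<le>n. m * (coeff p i * N ^ i * m ^ (n - i))) + N ^ Suc n * coeff p (Suc n)"
      by (simp add: Suc_diff_le mult_ac)
    finally have "N ^ Suc n * coeff p (Suc n) = m * (- (\<Sum>i\<le>n. coeff p i * N ^ i * m ^ (n - i)))"
      by (simp add: eq_neg_iff_add_eq_0 add.commute flip: sum_distrib_left)
    moreover have "- (\<Sum>i\<le>n. coeff p i * N ^ i * m ^ (n - i)) \<in> D"
      by (intro subring_uminus[OF D(1)] subring_sum[OF D(1)] subring_mult[OF D(1)]
          subring_power[OF D(1)] cD D)
    ultimately obtain r where r: "r \<in> D" "coeff p (Suc n) = m * r"
      using dvd_pow cD by blast
    define p' where "p' = p - [:- N, m:] * monom r n"
    have "coeff p' k = 0" if "k > n" for k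
    proof (cases "k = Suc n")
      case True
      then show ?thesis by (simp add: p'_def r mult_pCons_left coeff_monom)
    next
      case False
      then have "coeff p k = 0" using that Suc by (intro coeff_eq_0) auto
      then show ?thesis
        using that False by (simp add: p'_def coeff_monom coeff_pCons split: nat.split)
    qed
    then have "degree p' \<le> n" by (intro degree_le) auto
    moreover have L: "[:- N, m:] \<in> polys D"
      using D subring_uminus[OF D(1)] subring_0[OF polys_ring] by (auto simp: polys_pCons)
    have "p' \<in> polys D"
      unfolding p'_def
      by (intro subring_diff[OF polys_ring] subring_mult[OF polys_ring] L less.prems polys_monom D r)
    moreover have "poly p' (N / m) = 0"
      using less.prems(2) D(4) by (simp add: p'_def)
    ultimately obtain q where q: "q \<in> polys D" "p' = [:- N, m:] * q"
      using less.hyps[of p'] Suc by auto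
    have "p = [:- N, m:] * (q + monom r n)"
      using q(2) by (simp only: p'_def diff_eq_eq distrib_left)
    then show ?thesis
      using subring_add[OF polys_ring q(1) polys_monom[OF D(1) r(1)]] by blast
  qed
qed

lemma polys_ideal_combination:
  assumes "is_subring D" "\<And>i. \<exists>s\<in>D. \<exists>t\<in>D. coeff p i = u * s + v * t"
  shows "\<exists>p1\<in>polys D. \<exists>p2\<in>polys D. p = smult u p1 + smult v p2"
  using assms(2)
proof (induction p)
  case 0
  then show ?case using subring_0[OF is_subring_polys[OF assms(1)]] by force
next
  case (pCons c p)
  have "\<exists>s\<in>D. \<exists>t\<in>D. coeff p i = u * s + v * t" for i
    using pCons.prems[of "Suc i"] by simp
  then obtain p1 p2 where "p1 \<in> polys D" "p2 \<in> polys D" "p = smult u p1 + smult v p2"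
    using pCons.IH by blast
  moreover obtain s t where "s \<in> D" "t \<in> D" "c = u * s + v * t"
    using pCons.prems[of 0] by auto
  ultimately show ?case
    by (intro bexI[of _ "pCons s p1"] bexI[of _ "pCons t p2"]) (auto simp: polys_pCons)
qed

text \<open>The three factors of \<open>u v w\<close> are split off one at a time, each by the
  single-variable cancellation in rotated variables. This is the coprimality hypothesis of
  \<open>linear_factor_coprime\<close>.\<close>

lemma markov_coprime:
  assumes i: "independent3 u v w" and a: "a > 0"
    and d: "d \<in> subring_generated {u, v, w}" "r \<in> subring_generated {u, v, w}"
    and eq: "(u ^ a + v ^ a + w ^ a) * d = u * v * w * r"
  shows "\<exists>r'\<in>subring_generated {u, v, w}. d = u * v * w * r'"
proof -
  let ?D = "subring_generated {u, v, w}"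
  note D = is_subring_generated[of "{u, v, w}"]
  have vars: "u \<in> ?D" "v \<in> ?D" "w \<in> ?D" using subring_generated_superset[of "{u, v, w}"] by auto
  note nz = independent3_neq_0[OF i]
  have sets: "{v, w, u} = {u, v, w}" "{w, u, v} = {u, v, w}" by auto
  have "v * w * r \<in> ?D" "w * r \<in> ?D" by (intro subring_mult[OF D] vars d)+
  moreover obtain d1 where d1: "d1 \<in> ?D" "d = u * d1"
    using independent3_dvd_cancel[OF i a d(1) \<open>v * w * r \<in> ?D\<close>] eq by (auto simp: mult_ac)
  moreover have eq1: "(u ^ a + v ^ a + w ^ a) * d1 = v * (w * r)"
  proof -
    have "u * ((u ^ a + v ^ a + w ^ a) * d1) = u * (v * (w * r))"
      using eq by (simp add: d1 mult_ac)
    then show ?thesis using nz by simp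
  qed
  ultimately obtain d2 where d2: "d2 \<in> ?D" "d1 = v * d2"
    using independent3_dvd_cancel[OF independent3_rotate[OF i] a, of d1 "w * r"]
    by (auto simp: sets add_ac)
  have "(u ^ a + v ^ a + w ^ a) * d2 = w * r"
  proof -
    have "v * ((u ^ a + v ^ a + w ^ a) * d2) = v * (w * r)"
      using eq1 by (simp add: d2 mult_ac)
    then show ?thesis using nz by simp
  qed
  then obtain d3 where "d3 \<in> ?D" "d2 = w * d3"
    using independent3_dvd_cancel[OF independent3_rotate[OF independent3_rotate[OF i]] a, of d2 r] d2 d
    by (auto simp: sets add_ac)
  then show ?thesis using d1 d2 by (intro bexI[of _ d3]) auto
qed

text \<open>By Gauss's lemma, lifts \<open>G\<close>, \<open>H\<close> of \<open>u f\<close>,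
  \<open>v f\<close> satisfy \<open>v G - u H = L R\<close> with \<open>L = m X - N\<close>. Modulo
  \<open>u\<close> and \<open>v\<close>, \<open>L\<close> is \<open>- w^a\<close>, which is
  cancellable there, so \<open>R\<close> lies in the ideal of \<open>u\<close> and \<open>v\<close>;
  correcting the lifts by multiples of \<open>L\<close> then makes \<open>u\<close> divide the lift
  of \<open>u f\<close>.\<close>

lemma markov_regular_sequence:
  assumes i: "independent3 u v w" and a: "a > 0"
    and M: "M = (u ^ a + v ^ a + w ^ a) / (u * v * w)"
    and f: "u * f \<in> adjoin (subring_generated {u, v, w}) M" "v * f \<in> adjoin (subring_generated {u, v, w}) M"
  shows "f \<in> adjoin (subring_generated {u, v, w}) M"
proof -
  define D where "D = subring_generated {u, v, w}"
  have D: "is_subring D" unfolding D_def by (rule is_subring_generated)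
  have vars: "u \<in> D" "v \<in> D" "w \<in> D"
    unfolding D_def using subring_generated_superset[of "{u, v, w}"] by auto
  note nz = independent3_neq_0[OF i]
  define m where "m = u * v * w"
  define N where "N = u ^ a + v ^ a + w ^ a"
  have mN: "m \<in> D" "N \<in> D" "m \<noteq> 0"
    unfolding m_def N_def using nz
    by (auto intro!: subring_mult[OF D] subring_add[OF D] subring_power[OF D] vars)
  note M' = M[folded m_def N_def]
  note PR = is_subring_polys[OF D]
  define L where "L = [:- N, m:]"
  have L: "L \<in> polys D" "poly L M = 0"
    unfolding L_def using mN subring_uminus[OF D] subring_0[OF PR] by (auto simp: polys_pCons M')
  obtain G where G: "G \<in> polys D" "u * f = poly G M" using f(1) by (auto simp: adjoin_def D_def)
  obtain H where H: "H \<in> polys D" "v * f = poly H M" using f(2) by (auto simp: adjoin_def D_def)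
  have smult_D: "smult c p \<in> polys D" if "c \<in> D" "p \<in> polys D" for c p
    using that by (auto simp: polys_def intro: subring_mult[OF D])
  have "smult v G - smult u H \<in> polys D"
    by (intro subring_diff[OF PR] smult_D vars G H)
  moreover have "poly (smult v G - smult u H) (N / m) = 0"
    by (simp add: M'[symmetric] G(2)[symmetric] H(2)[symmetric])
  ultimately obtain R where R: "R \<in> polys D" "smult v G - smult u H = L * R"
    using linear_factor_coprime[OF D mN, of "smult v G - smult u H"]
      markov_coprime[OF i a, folded D_def m_def N_def]
    unfolding L_def by blast
  have "\<exists>s\<in>D. \<exists>t\<in>D. coeff R j = u * s + v * t" for j
  proof -
    \<comment> \<open>\<open>R'\<close> is coefficient \<open>j - 1\<close> of \<open>R\<close>,
      taken as 0 for \<open>j = 0\<close>, so that coefficient \<open>j\<close> of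
      \<open>L * R\<close> is \<open>m R' - N (coeff R j)\<close>.\<close>
    define R' where "R' = (case j of 0 \<Rightarrow> 0 | Suc k \<Rightarrow> coeff R k)"
    have R'D: "R' \<in> D" unfolding R'_def using R(1) subring_0[OF D] by (auto simp: polys_def split: nat.split)
    have "coeff (smult v G - smult u H) j = m * R' - N * coeff R j"
      unfolding R(2) L_def R'_def by (simp add: coeff_pCons split: nat.split)
    then have "w ^ a * coeff R j = u * (v * w * R' + coeff H j - u ^ (a - 1) * coeff R j)
        + v * (- coeff G j - v ^ (a - 1) * coeff R j)"
      using a by (cases a) (simp_all add: N_def m_def algebra_simps)
    moreover have "v * w * R' + coeff H j - u ^ (a - 1) * coeff R j \<in> D"
        "- coeff G j - v ^ (a - 1) * coeff R j \<in> D" "coeff R j \<in> D"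
      using polys_coeff[OF R(1)] polys_coeff[OF G(1)] polys_coeff[OF H(1)] R'D vars
      by (auto intro!: subring_diff[OF D] subring_add[OF D] subring_mult[OF D] subring_power[OF D] subring_uminus[OF D])
    ultimately show ?thesis
      using independent3_prime_ideal[OF i, folded D_def] by blast
  qed
  then obtain R1 R2 where R12: "R1 \<in> polys D" "R2 \<in> polys D" "R = smult u R1 + smult v R2"
    using polys_ideal_combination[OF D] by blast
  \<comment> \<open>Inserting \<open>R = u R1 + v R2\<close> and collecting terms gives
    \<open>v K = u (H + L R1)\<close>, while \<open>K\<close> and \<open>G\<close> have the same
    value at \<open>M\<close>. Since \<open>v\<close> is cancellable modulo \<open>u\<close>,
    \<open>u\<close> divides \<open>K\<close>.\<close>
  define K where "K = G - L * R2"
  have "smult v K = smult u (H + L * R1)"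
    using R(2) by (simp add: K_def R12(3) algebra_simps smult_add_right smult_diff_right)
  then have cK: "v * coeff K j = u * coeff (H + L * R1) j" for j
    by (metis coeff_smult)
  have KD: "K \<in> polys D" "H + L * R1 \<in> polys D"
    unfolding K_def
    by (intro subring_diff[OF PR] subring_add[OF PR] subring_mult[OF PR] G H L R12)+
  \<comment> \<open>The second generator is 0, so that the lemma on ideals with two generators also
    covers divisibility by \<open>u\<close> alone.\<close>
  have "\<exists>s\<in>D. \<exists>t\<in>D. coeff K j = u * s + 0 * t" for j
    using independent3_dvd_cancel2[OF i _ _ cK] KD polys_coeff unfolding D_def by fastforce
  then obtain K' where K': "K' \<in> polys D" "K = smult u K'"
    using polys_ideal_combination[OF D, of K u 0] by auto
  have "u * f = u * poly K' M"
    using G(2) L(2) K'(2) by (metis K_def diff_zero mult_zero_left poly_diff poly_mult poly_smult)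
  then have "f = poly K' M" using nz by simp
  then show ?thesis using K'(1) by (auto simp: adjoin_def D_def)
qed

text \<open>Strip the powers one factor at a time: first those of \<open>v\<close> with a single
  \<open>u\<close> fixed, then those of \<open>u\<close>.\<close>

lemma regular_sequence_power:
  fixes f :: "'f::comm_ring_1"
  assumes S: "is_subring S" "u \<in> S" "v \<in> S"
    and reg: "\<And>f. u * f \<in> S \<Longrightarrow> v * f \<in> S \<Longrightarrow> f \<in> S"
    and f: "u ^ i * f \<in> S" "v ^ j * f \<in> S"
  shows "f \<in> S"
proof -
  have step: "g \<in> S" if "u * g \<in> S" "v ^ j * g \<in> S" for g j
    using that
  proof (induction j arbitrary: g)
    case (Suc j)
    have "u * (v ^ j * g) \<in> S"
      using subring_mult[OF S(1) subring_power[OF S(1,3)] Suc.prems(1), of j] by (simp add: mult_ac)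
    moreover have "v * (v ^ j * g) \<in> S" using Suc.prems(2) by (simp add: mult_ac)
    ultimately show ?case using reg Suc by blast
  qed simp
  show ?thesis using f
  proof (induction i)
    case (Suc i)
    have "u * (u ^ i * f) \<in> S" using Suc.prems(1) by (simp add: mult_ac)
    moreover have "v ^ j * (u ^ i * f) \<in> S"
      using subring_mult[OF S(1) subring_power[OF S(1,2)] Suc.prems(2), of i] by (simp add: mult_ac)
    ultimately show ?case using step Suc by blast
  qed simp
qed

text \<open>\<open>T\<close> is \<open>S\<close> with \<open>v w\<close> inverted. It contains
  \<open>Z[v, 1/v, w, 1/w]\<close>, \<open>u\<close> and the mutated variable, hence both summands
  that \<open>laurent_exchange\<close> yields.\<close>

lemma markov_denominator:
  assumes i: "independent3 u v w" and a: "a > 0"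
    and M: "M = (u ^ a + v ^ a + w ^ a) / (u * v * w)"
    and S: "is_subring S" "u \<in> S" "v \<in> S" "w \<in> S" "M \<in> S"
    and f: "f \<in> laurent_ring {u, v, w}" "f \<in> laurent_ring {(v ^ a + w ^ a) / u, v, w}"
  shows "\<exists>K. (v * w) ^ K * f \<in> S"
proof -
  note nz = independent3_neq_0[OF i]
  define T where "T = {f. \<exists>K. (v * w) ^ K * f \<in> S}"
  have vwS: "(v * w) ^ k \<in> S" for k
    by (intro subring_power[OF S(1)] subring_mult[OF S(1)] S)
  have T: "is_subring T"
    unfolding is_subring_def
  proof (intro conjI ballI)
    show "1 \<in> T" unfolding T_def using vwS by auto
    fix g h assume "g \<in> T" "h \<in> T"
    then obtain k l where kl: "(v * w) ^ k * g \<in> S" "(v * w) ^ l * h \<in> S" unfolding T_def by blast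
    have eq: "(v * w) ^ (k + l) * (g - h) = (v * w) ^ l * ((v * w) ^ k * g) - (v * w) ^ k * ((v * w) ^ l * h)"
      "(v * w) ^ (k + l) * (g * h) = ((v * w) ^ k * g) * ((v * w) ^ l * h)"
      by (simp_all add: power_add algebra_simps)
    have "(v * w) ^ (k + l) * (g - h) \<in> S" "(v * w) ^ (k + l) * (g * h) \<in> S"
      unfolding eq by (intro subring_diff[OF S(1)] subring_mult[OF S(1)] kl vwS)+
    then show "g - h \<in> T" "g * h \<in> T" unfolding T_def by blast+
  qed
  have ST: "S \<subseteq> T" unfolding T_def by (auto intro: exI[of _ 0])
  have "(v * w) ^ 1 * inverse v \<in> S" "(v * w) ^ 1 * inverse w \<in> S"
    using nz S by (auto simp: field_simps)
  then have inv: "inverse v \<in> T" "inverse w \<in> T" unfolding T_def by blast+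
  have L: "laurent_ring {v, w} \<subseteq> T"
    by (rule laurent_ring_least[OF T]) (use ST S inv in auto)
  define P where "P = v ^ a + w ^ a"
  have P0: "P \<noteq> 0"
    unfolding P_def by (rule independent3_power_sum_neq_0[OF independent3_rotate[OF i] a])
  \<comment> \<open>\<open>v w M = (u^a + P) / u\<close>, so the mutated variable is a polynomial in
    the four generators.\<close>
  have "P / u = v * w * M - u ^ (a - 1)"
    using a nz by (cases a) (auto simp: M P_def field_simps)
  then have "P / u \<in> S"
    using S by (auto intro!: subring_diff[OF S(1)] subring_mult[OF S(1)] subring_power[OF S(1)])
  then have uT: "u \<in> T" "P / u \<in> T" using ST S by auto
  have "P \<in> laurent_ring {v, w}"
    unfolding P_def by (intro laurent_ring_intros laurent_ring_var) auto
  then obtain g k where "g \<in> adjoin (laurent_ring {v, w}) u" "k \<in> adjoin (laurent_ring {v, w}) (P / u)" "f = g + k"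
    using laurent_exchange[OF is_subfield_generated subfield_generated_superset _ _ P0, of "{v, w}" u f] f i
    unfolding independent3_def P_def by blast
  then have "f \<in> T"
    using adjoin_least[OF T L uT(1)] adjoin_least[OF T L uT(2)] subring_add[OF T] by blast
  then show ?thesis by (simp add: T_def)
qed

lemma markov_upper_bound:
  assumes i: "independent3 u v w" and a: "a > 0"
    and M: "M = (u ^ a + v ^ a + w ^ a) / (u * v * w)"
    and f: "f \<in> laurent_ring {u, v, w}" "f \<in> laurent_ring {(v ^ a + w ^ a) / u, v, w}"
      "f \<in> laurent_ring {u, (u ^ a + w ^ a) / v, w}" "f \<in> laurent_ring {u, v, (u ^ a + v ^ a) / w}"
  shows "f \<in> subring_generated {u, v, w, M}"
proof -
  define S where "S = adjoin (subring_generated {u, v, w}) M"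
  have S_eq: "S = subring_generated {u, v, w, M}"
    unfolding S_def using subring_generated_insert[of M "{u, v, w}"] by (simp add: insert_commute)
  have S: "is_subring S" unfolding S_eq by (rule is_subring_generated)
  have vars: "u \<in> S" "v \<in> S" "w \<in> S" "M \<in> S"
    unfolding S_eq using subring_generated_superset[of "{u, v, w, M}"] by auto
  note i2 = independent3_rotate[OF i] and i3 = independent3_rotate[OF independent3_rotate[OF i]]
  have sets: "{v, w, u} = {u, v, w}" "{w, u, v} = {u, v, w}" by auto
  have M2: "M = (v ^ a + w ^ a + u ^ a) / (v * w * u)" and M3: "M = (w ^ a + u ^ a + v ^ a) / (w * u * v)"
    unfolding M by (simp_all add: ac_simps)
  have reg: "g \<in> S" if "u * g \<in> S" "v * g \<in> S" for g
    using markov_regular_sequence[OF i a M] that unfolding S_def by blast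
  have reg2: "g \<in> S" if "v * g \<in> S" "w * g \<in> S" for g
    using markov_regular_sequence[OF i2 a M2] that unfolding S_def sets by blast
  have reg3: "g \<in> S" if "w * g \<in> S" "u * g \<in> S" for g
    using markov_regular_sequence[OF i3 a M3] that unfolding S_def sets by blast
  obtain k1 where k1: "(v * w) ^ k1 * f \<in> S"
    using markov_denominator[OF i a M S vars f(1,2)] by blast
  obtain k2 where k2: "(w * u) ^ k2 * f \<in> S"
    using markov_denominator[OF i2 a M2 S vars(2,3,1,4), of f] f(1,3)
    by (auto simp: insert_commute add.commute)
  obtain k3 where k3: "(u * v) ^ k3 * f \<in> S"
    using markov_denominator[OF i3 a M3 S vars(3,1,2,4), of f] f(1,4)
    by (auto simp: insert_commute add.commute)
  define K where "K = k1 + k2 + k3"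
  have raise: "(x * y) ^ K * f \<in> S" if "(x * y) ^ k * f \<in> S" "k \<le> K" "x \<in> S" "y \<in> S" for x y k
  proof -
    have "(x * y) ^ K * f = (x * y) ^ (K - k) * ((x * y) ^ k * f)"
      using that(2) by (simp flip: power_add mult.assoc)
    then show ?thesis
      using that subring_mult[OF S] subring_power[OF S] by metis
  qed
  have k: "(v * w) ^ K * f \<in> S" "(w * u) ^ K * f \<in> S" "(u * v) ^ K * f \<in> S"
    using raise[OF k1] raise[OF k2] raise[OF k3] vars by (auto simp: K_def)
  \<comment> \<open>\<open>v^K\<close> and \<open>w^K\<close> both carry \<open>u^K f\<close> into
    \<open>S\<close>, so the pair \<open>v, w\<close> gives \<open>u^K f\<close> in
    \<open>S\<close>. The pair \<open>w, u\<close> likewise gives \<open>v^K f\<close>, and the pair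
    \<open>u, v\<close> finally gives \<open>f\<close>.\<close>
  have "u ^ K * f \<in> S"
    by (rule regular_sequence_power[OF S vars(2,3) reg2, of K _ K])
       (use k in \<open>simp_all add: power_mult_distrib mult_ac\<close>)
  moreover have "v ^ K * f \<in> S"
    by (rule regular_sequence_power[OF S vars(3,1) reg3, of K _ K])
       (use k in \<open>simp_all add: power_mult_distrib mult_ac\<close>)
  ultimately show ?thesis
    unfolding S_eq[symmetric] using regular_sequence_power[OF S vars(1,2), of K f K] reg by blast
qed

section \<open>Algebraic independence\<close>

abbreviation "lookup \<equiv> Poly_Mapping.lookup"
abbreviation "keys \<equiv> Poly_Mapping.keys"
abbreviation "single \<equiv> Poly_Mapping.single"

lemma poly_mapping_sum_single:
  fixes p :: "'a \<Rightarrow>\<^sub>0 'b::comm_monoid_add"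
  shows "p = (\<Sum>m\<in>keys p. single m (lookup p m))"
proof (rule poly_mapping_eqI)
  fix k
  have "lookup (\<Sum>m\<in>keys p. single m (lookup p m)) k = (\<Sum>m\<in>keys p. if m = k then lookup p m else 0)"
    unfolding lookup_sum lookup_single by (rule sum.cong) (auto simp: when_def)
  then show "lookup p k = lookup (\<Sum>m\<in>keys p. single m (lookup p m)) k"
    by (simp add: in_keys_iff)
qed

lemma poly_mapping_add_closed_induct [case_names 0 single add]:
  fixes p :: "'a \<Rightarrow>\<^sub>0 'b::comm_monoid_add"
  assumes "P 0" "\<And>m a. P (single m a)" "\<And>p q. P p \<Longrightarrow> P q \<Longrightarrow> P (p + q)"
  shows "P p"
proof -
  have "P (\<Sum>m\<in>A. single m (lookup p m))" for A
    by (induction A rule: infinite_finite_induct) (use assms in auto)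
  then show ?thesis using poly_mapping_sum_single[of p] by metis
qed

text \<open>Used for two coefficient maps: \<open>of_int\<close> for the ideal of relations,
  \<open>of_rat\<close> for algebraic independence.\<close>

locale coeff_hom =
  fixes c :: "'a::comm_ring_1 \<Rightarrow> 'f::comm_ring_1"
  assumes c0: "c 0 = 0" and c1: "c 1 = 1"
    and c_add: "\<And>a b. c (a + b) = c a + c b" and c_mult: "\<And>a b. c (a * b) = c a * c b"
begin

lemma poly_eval_superset:
  assumes "finite A" "keys p \<subseteq> A"
  shows "poly_eval c y p = (\<Sum>m\<in>A. c (lookup p m) * (\<Prod>i\<in>UNIV. y $ i ^ lookup m i))"
  unfolding poly_eval_def
  by (rule sum.mono_neutral_left) (use assms c0 in \<open>auto simp: in_keys_iff\<close>)

lemma poly_eval_0: "poly_eval c y 0 = 0"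
  by (simp add: poly_eval_def)

lemma poly_eval_add: "poly_eval c y (p + q) = poly_eval c y p + poly_eval c y q"
proof -
  let ?A = "keys p \<union> keys q"
  have "finite ?A" "keys (p + q) \<subseteq> ?A" by (auto dest: keys_add[THEN subsetD])
  then show ?thesis
    by (simp add: poly_eval_superset[of ?A] lookup_add c_add algebra_simps sum.distrib)
qed

lemma poly_eval_uminus: "poly_eval c y (- p) = - poly_eval c y p"
  using poly_eval_add[of y p "- p"] by (simp add: poly_eval_0 eq_neg_iff_add_eq_0 add.commute)

lemma poly_eval_diff: "poly_eval c y (p - q) = poly_eval c y p - poly_eval c y q"
  using poly_eval_add[of y p "- q"] by (simp add: poly_eval_uminus)

lemma poly_eval_sum: "poly_eval c y (sum f A) = (\<Sum>i\<in>A. poly_eval c y (f i))"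
  by (induction A rule: infinite_finite_induct) (auto simp: poly_eval_0 poly_eval_add)

lemma poly_eval_single: "poly_eval c y (single m a) = c a * (\<Prod>i\<in>UNIV. y $ i ^ lookup m i)"
  by (subst poly_eval_superset[of "{m}"]) auto

lemma poly_eval_mult: "poly_eval c y (p * q) = poly_eval c y p * poly_eval c y q"
proof (induction p rule: poly_mapping_add_closed_induct)
  case (single m a)
  show ?case
    by (induction q rule: poly_mapping_add_closed_induct)
       (simp_all add: poly_eval_0 poly_eval_add poly_eval_single mult_single c_mult lookup_add
          power_add prod.distrib algebra_simps)
qed (simp_all add: poly_eval_0 poly_eval_add algebra_simps)

lemma poly_eval_1: "poly_eval c y 1 = 1"
  using poly_eval_single[of y 0 1] by (simp add: c1)

lemma poly_eval_power: "poly_eval c y (p ^ n) = poly_eval c y p ^ n"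
  by (induction n) (auto simp: poly_eval_1 poly_eval_mult)

lemma poly_eval_symb: "poly_eval c y (symb i) = y $ i"
proof -
  have "(\<Prod>j\<in>UNIV. y $ j ^ lookup (single i (1::nat)) j) = (\<Prod>j\<in>UNIV. if j = i then y $ j else 1)"
    by (rule prod.cong) (auto simp: lookup_single when_def)
  then show ?thesis
    unfolding symb_def by (simp add: poly_eval_single c1)
qed

lemma is_subring_poly_eval_range: "is_subring (range (poly_eval c y))"
  unfolding is_subring_def
proof (intro conjI ballI)
  show "1 \<in> range (poly_eval c y)" by (metis poly_eval_1 rangeI)
  fix u v assume "u \<in> range (poly_eval c y)" "v \<in> range (poly_eval c y)"
  then show "u - v \<in> range (poly_eval c y)" "u * v \<in> range (poly_eval c y)"
    by (auto simp flip: poly_eval_diff poly_eval_mult)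
qed

end

interpretation of_int_eval: coeff_hom "of_int :: int \<Rightarrow> 'f::comm_ring_1"
  by unfold_locales auto

interpretation of_rat_eval: coeff_hom "of_rat :: rat \<Rightarrow> 'f::field_char_0"
  by unfold_locales (auto simp: of_rat_add of_rat_mult)

section \<open>From algebraic independence to transcendence over subfields\<close>

definition alg_independent :: "'f::field_char_0 ^ 'n::finite \<Rightarrow> bool" where
  "alg_independent x \<longleftrightarrow> (\<forall>p. poly_eval of_rat x p = 0 \<longrightarrow> p = 0)"

text \<open>The injection \<open>f\<close> leaves the index set free: below it is the identity, and
  later the map that forgets the exponent of one symbol.\<close>

lemma alg_independent_monomials:
  assumes x: "alg_independent x" and f: "finite I" "inj_on f I"
    and s: "(\<Sum>i\<in>I. of_rat (q i) * (\<Prod>j\<in>UNIV. x $ j ^ lookup (f i) j)) = 0" and i: "i \<in> I"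
  shows "q i = 0"
proof -
  have "poly_eval of_rat x (\<Sum>i\<in>I. single (f i) (q i)) = 0"
    using s by (simp add: of_rat_eval.poly_eval_sum of_rat_eval.poly_eval_single)
  then have "(\<Sum>i\<in>I. single (f i) (q i)) = 0"
    using x by (simp add: alg_independent_def)
  then have "0 = (\<Sum>k\<in>I. lookup (single (f k) (q k)) (f i))"
    by (metis lookup_sum lookup_zero)
  also have "\<dots> = (\<Sum>k\<in>I. if k = i then q k else 0)"
    by (rule sum.cong) (use f(2) i in \<open>auto simp: lookup_single when_def inj_on_def\<close>)
  finally show ?thesis using f(1) i by simp
qed

text \<open>The ring of rational polynomials in the variables other than \<open>x $ i\<close>.
  Recording that \<open>i\<close> is absent from the keys allows a relation over it to be lifted to
  a relation among symbols.\<close>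

definition eval_without :: "'f::field_char_0 ^ 'n::finite \<Rightarrow> 'n \<Rightarrow> 'f set" where
  "eval_without x i = {poly_eval of_rat x p |p. \<forall>m\<in>keys p. lookup m i = 0}"

lemma is_subring_eval_without: "is_subring (eval_without x i)"
  unfolding is_subring_def
proof (intro conjI ballI)
  show "1 \<in> eval_without x i"
    unfolding eval_without_def
    by (auto intro!: exI[of _ 1] simp: of_rat_eval.poly_eval_1)
  fix u v assume "u \<in> eval_without x i" "v \<in> eval_without x i"
  then obtain p q where p: "u = poly_eval of_rat x p" "\<forall>m\<in>keys p. lookup m i = 0"
    and q: "v = poly_eval of_rat x q" "\<forall>m\<in>keys q. lookup m i = 0"
    by (auto simp: eval_without_def)
  have "\<forall>m\<in>keys (p - q). lookup m i = 0"
  proof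
    fix m assume "m \<in> keys (p - q)"
    then have "m \<in> keys p \<or> m \<in> keys q" by (auto simp: in_keys_iff lookup_minus)
    then show "lookup m i = 0" using p q by auto
  qed
  moreover have "\<forall>m\<in>keys (p * q). lookup m i = 0"
    using keys_mult[of p q] p(2) q(2) by (auto simp: lookup_add)
  ultimately show "u - v \<in> eval_without x i" "u * v \<in> eval_without x i"
    unfolding eval_without_def p(1) q(1)
    by (auto simp flip: of_rat_eval.poly_eval_diff of_rat_eval.poly_eval_mult)
qed

lemma eval_without_var: "j \<noteq> i \<Longrightarrow> x $ j \<in> eval_without x i"
  unfolding eval_without_def
proof (rule CollectI, intro exI conjI)
  show "x $ j = poly_eval of_rat x (symb j)" by (simp add: of_rat_eval.poly_eval_symb)
qed (auto simp: symb_def lookup_single)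

lemma transcendental_eval_without:
  assumes x: "alg_independent x"
  shows "transcendental_over (eval_without x i) (x $ i)"
  unfolding transcendental_over_def
proof
  fix p assume "p \<in> polys (eval_without x i)"
  then show "poly p (x $ i) = 0 \<longrightarrow> p = 0"
  proof (induction p)
    case (pCons c p)
    then have c: "c \<in> eval_without x i" and p: "p \<in> polys (eval_without x i)"
      by (auto simp: polys_pCons)
    let ?R = "range (poly_eval of_rat x)"
    have R: "is_subring ?R" by (rule of_rat_eval.is_subring_poly_eval_range)
    have "x $ i \<in> ?R" by (metis of_rat_eval.poly_eval_symb rangeI)
    moreover have "eval_without x i \<subseteq> ?R" by (auto simp: eval_without_def)
    ultimately have "poly p (x $ i) \<in> ?R" using polys_poly_in[OF R] p by blast
    then obtain q where q: "poly p (x $ i) = poly_eval of_rat x q" by blast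
    obtain r where r: "c = poly_eval of_rat x r" "\<forall>m\<in>keys r. lookup m i = 0"
      using c by (auto simp: eval_without_def)
    show ?case
    proof
      assume "poly (pCons c p) (x $ i) = 0"
      then have "poly_eval of_rat x (r + symb i * q) = 0"
        by (simp add: q r of_rat_eval.poly_eval_add of_rat_eval.poly_eval_mult of_rat_eval.poly_eval_symb)
      then have "r + symb i * q = 0" using x by (simp add: alg_independent_def)
      \<comment> \<open>No monomial of \<open>r\<close> contains symbol \<open>i\<close>, whereas
        every monomial of \<open>symb i * q\<close> does, so both vanish. Thus the constant
        coefficient is 0 and \<open>x $ i\<close> can be cancelled.\<close>
      then have "r = - (symb i * q)" by (simp add: eq_neg_iff_add_eq_0)
      then have kr: "keys r = keys (symb i * q)" by (simp add: keys.rep_eq)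
      have "lookup m i > 0" if "m \<in> keys (symb i * q)" for m
        using that keys_mult[of "symb i" q] by (auto simp: symb_def lookup_add)
      then have "keys r = {}" using r(2) kr by fastforce
      then have "r = 0" by (metis in_keys_iff empty_iff poly_mapping_eqI lookup_zero)
      then have "c = 0" "symb i * q = 0"
        using r(1) \<open>r + symb i * q = 0\<close> by (simp_all add: of_rat_eval.poly_eval_0)
      have "symb i \<noteq> (0 :: ('b, rat) poly_ring)"
        unfolding symb_def by (metis lookup_single_eq lookup_zero zero_neq_one)
      then have "x $ i \<noteq> 0"
        using x by (metis alg_independent_def of_rat_eval.poly_eval_symb)
      moreover have "x $ i * poly p (x $ i) = 0"
        using \<open>poly (pCons c p) (x $ i) = 0\<close> \<open>c = 0\<close> by simp
      ultimately show "pCons c p = 0" using pCons.IH p \<open>c = 0\<close> by simp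
    qed
  qed simp
qed

text \<open>The fraction field of \<open>E\<close> inside the ambient field, phrased through a
  denominator that can be cleared.\<close>

definition fractions :: "'f::field set \<Rightarrow> 'f set" where
  "fractions E = {e. \<exists>s\<in>E. s \<noteq> 0 \<and> s * e \<in> E}"

lemma is_subfield_fractions:
  assumes E: "is_subring E" shows "is_subfield (fractions E)"
  unfolding is_subfield_def is_subring_def
proof (intro conjI ballI)
  show "1 \<in> fractions E"
    unfolding fractions_def using subring_1[OF E] by (auto intro!: bexI[of _ 1])
  fix u v assume "u \<in> fractions E" "v \<in> fractions E"
  then obtain s t where st: "s \<in> E" "s \<noteq> 0" "s * u \<in> E" "t \<in> E" "t \<noteq> 0" "t * v \<in> E"
    by (auto simp: fractions_def)
  have eq: "s * t * (u - v) = t * (s * u) - s * (t * v)" "s * t * (u * v) = (s * u) * (t * v)"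
    by (simp_all add: algebra_simps)
  have "s * t * (u - v) \<in> E" "s * t * (u * v) \<in> E" "s * t \<in> E"
    unfolding eq by (intro subring_diff[OF E] subring_mult[OF E] st)+
  then show "u - v \<in> fractions E" "u * v \<in> fractions E"
    unfolding fractions_def using st by (auto intro!: bexI[of _ "s * t"])
next
  fix u assume "u \<in> fractions E"
  then obtain s where s: "s \<in> E" "s \<noteq> 0" "s * u \<in> E" by (auto simp: fractions_def)
  show "inverse u \<in> fractions E"
  proof (cases "u = 0")
    case True
    then show ?thesis using s by (auto simp: fractions_def)
  next
    case False
    then show ?thesis
      unfolding fractions_def using s by (auto simp: mult.assoc intro!: bexI[of _ "s * u"])
  qed
qed

lemma fractions_superset: "is_subring E \<Longrightarrow> E \<subseteq> fractions E"
  unfolding fractions_def using subring_1 by (auto intro!: bexI[of _ 1])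

lemma transcendental_fractions:
  assumes E: "is_subring E" "transcendental_over E y"
  shows "transcendental_over (fractions E) y"
  unfolding transcendental_over_def
proof (intro ballI impI)
  fix p assume p: "p \<in> polys (fractions E)" "poly p y = 0"
  have "\<exists>s\<in>E. s \<noteq> 0 \<and> smult s p \<in> polys E"
    using p(1)
  proof (induction p)
    case 0
    then show ?case
      using subring_1[OF E(1)] subring_0[OF is_subring_polys[OF E(1)]] by (intro bexI[of _ 1]) auto
  next
    case (pCons c p)
    then have "c \<in> fractions E" "p \<in> polys (fractions E)" by (auto simp: polys_pCons)
    then obtain s t where st: "s \<in> E" "s \<noteq> 0" "s * c \<in> E" "t \<in> E" "t \<noteq> 0" "smult t p \<in> polys E"
      using pCons.IH by (auto simp: fractions_def)
    have "s * (t * coeff p n) \<in> E" for n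
      by (intro subring_mult[OF E(1)] st polys_coeff[OF st(6), simplified])
    then have "smult (s * t) p \<in> polys E"
      by (auto simp: polys_def mult.assoc)
    moreover have "t * (s * c) \<in> E" "s * t \<in> E" using st by (auto intro: subring_mult[OF E(1)])
    ultimately show ?case
      using st by (intro bexI[of _ "s * t"]) (auto simp: polys_pCons mult_ac)
  qed
  then obtain s where "s \<in> E" "s \<noteq> 0" "smult s p \<in> polys E" by blast
  then show "p = 0"
    using E(2) p(2) by (auto simp: transcendental_over_def)
qed

lemma transcendental_mono: "E \<subseteq> F \<Longrightarrow> transcendental_over F y \<Longrightarrow> transcendental_over E y"
  using polys_mono[of E F] by (auto simp: transcendental_over_def)

text \<open>The subfield lies in the fraction field of \<open>eval_without x i\<close>, and clearing
  denominators reduces a relation to one over that ring.\<close>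

lemma alg_independent_transcendental:
  assumes "alg_independent x"
  shows "transcendental_over (subfield_generated (($) x ` (- {i}))) (x $ i)"
proof -
  note E = is_subring_eval_without[of x i]
  have "subfield_generated (($) x ` (- {i})) \<subseteq> fractions (eval_without x i)"
    using fractions_superset[OF E] eval_without_var[of _ i x]
    by (intro subfield_generated_least is_subfield_fractions E) auto
  then show ?thesis
    by (rule transcendental_mono) (rule transcendental_fractions[OF E transcendental_eval_without[OF assms]])
qed

lemma subfield_of_rat:
  assumes F: "is_subfield F" shows "of_rat r \<in> F"
proof (cases r)
  case (Fract a b)
  then show ?thesis
    using is_subfield_subring[OF F]
    by (simp add: of_rat_rat divide_inverse subring_mult subring_of_int subfield_inverse[OF F])
qed

text \<open>Expand a relation among the \<open>y'\<close> in powers of \<open>y' $ k\<close>: its coefficients are relations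
  among the \<open>y\<close>.\<close>

lemma alg_independent_exchange:
  fixes y y' :: "'f::field_char_0 ^ 'n::finite"
  assumes y: "alg_independent y"
    and eq: "\<And>j. j \<noteq> k \<Longrightarrow> y' $ j = y $ j"
    and t: "transcendental_over (subfield_generated (($) y ` (- {k}))) (y' $ k)"
  shows "alg_independent y'"
  unfolding alg_independent_def
proof (intro allI impI)
  fix p assume p: "poly_eval of_rat y' p = 0"
  define F where "F = subfield_generated (($) y ` (- {k}))"
  have F: "is_subfield F" "($) y ` (- {k}) \<subseteq> F"
    unfolding F_def by (rule is_subfield_generated subfield_generated_superset)+
  note FR = is_subfield_subring[OF F(1)]
  define b where "b m = of_rat (lookup p m) * (\<Prod>j\<in>- {k}. y $ j ^ lookup m j)" for m
  define Q where "Q = (\<Sum>m\<in>keys p. monom (b m) (lookup m k))"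
  have split: "(\<Prod>j\<in>UNIV. z $ j ^ lookup m j) = z $ k ^ lookup m k * (\<Prod>j\<in>- {k}. z $ j ^ lookup m j)"
    for z :: "'f ^ 'n" and m
    using prod.remove[of UNIV k "\<lambda>j. z $ j ^ lookup m j"] by (simp add: Compl_eq_Diff_UNIV)
  have "poly Q (y' $ k) = poly_eval of_rat y' p"
    unfolding Q_def poly_sum poly_monom poly_eval_def b_def split
    by (rule sum.cong) (auto simp: eq mult_ac)
  then have "poly Q (y' $ k) = 0" using p by simp
  moreover have "Q \<in> polys F"
    unfolding Q_def b_def using F
    by (intro subring_sum[OF is_subring_polys[OF FR]] polys_monom[OF FR] subring_mult[OF FR]
        subring_prod[OF FR] subring_power[OF FR] subfield_of_rat[OF F(1)]) auto
  ultimately have Q0: "Q = 0" using t by (simp add: transcendental_over_def F_def)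
  show "p = 0"
  proof (rule poly_mapping_eqI)
    fix m
    show "lookup p m = lookup 0 m"
    proof (cases "m \<in> keys p")
      case True
      let ?I = "{n \<in> keys p. lookup n k = lookup m k}"
      have "0 = coeff Q (lookup m k) * y $ k ^ lookup m k" using Q0 by simp
      also have "\<dots> = (\<Sum>n\<in>keys p. if lookup n k = lookup m k then b n * y $ k ^ lookup m k else 0)"
        unfolding Q_def coeff_sum coeff_monom sum_distrib_right by (rule sum.cong) auto
      also have "\<dots> = (\<Sum>n\<in>?I. b n * y $ k ^ lookup m k)"
        by (simp add: sum.inter_filter)
      also have "\<dots> = (\<Sum>n\<in>?I. of_rat (lookup p n) * (\<Prod>j\<in>UNIV. y $ j ^ lookup n j))"
        unfolding split b_def by (rule sum.cong) (auto simp: mult_ac)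
      finally show ?thesis
        using alg_independent_monomials[OF y, of ?I id "lookup p" m] True by simp
    qed (simp add: in_keys_iff)
  qed
qed

lemma freely_generates_iff:
  "freely_generates x \<longleftrightarrow> alg_independent x \<and> subfield_generated (range (($) x)) = UNIV"
  by (simp add: freely_generates_def alg_independent_def)

text \<open>Independence survives because \<open>P / y $ k\<close> is again transcendental over the
  field of the other variables; generation survives because
  \<open>y $ k = P / y' $ k\<close>.\<close>

lemma freely_generates_exchange:
  fixes y y' :: "'f::field_char_0 ^ 'n::finite"
  assumes y: "freely_generates y"
    and eq: "\<And>j. j \<noteq> k \<Longrightarrow> y' $ j = y $ j"
    and k: "y' $ k = P / y $ k"
    and P: "P \<in> subfield_generated (($) y ` (- {k}))" "P \<noteq> 0"
  shows "freely_generates y'"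
proof -
  note alg = y[unfolded freely_generates_iff, THEN conjunct1]
  note gen = y[unfolded freely_generates_iff, THEN conjunct2]
  note F = is_subfield_subring[OF is_subfield_generated]
  note tk = alg_independent_transcendental[OF alg, of k]
  have t: "transcendental_over (subfield_generated (($) y ` (- {k}))) (y' $ k)"
    unfolding k by (rule transcendental_divide[OF F tk P])
  have "alg_independent y'"
    by (rule alg_independent_exchange[OF alg _ t]) (rule eq)
  moreover have "subfield_generated (range (($) y')) = UNIV"
  proof -
    let ?G = "subfield_generated (range (($) y'))"
    have G: "is_subfield ?G" "range (($) y') \<subseteq> ?G"
      by (rule is_subfield_generated subfield_generated_superset)+
    note FG = is_subfield_subring[OF G(1)]
    have y'j: "y' $ j \<in> ?G" for j using G(2) by blast
    have yj: "y $ j \<in> ?G" if "j \<noteq> k" for j using y'j[of j] eq[OF that] by simp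
    have "subfield_generated (($) y ` (- {k})) \<subseteq> ?G"
      by (rule subfield_generated_least[OF G(1)]) (use yj in auto)
    then have "P * inverse (y' $ k) \<in> ?G"
      by (intro subring_mult[OF FG] subfield_inverse[OF G(1)] y'j subsetD[OF _ P(1)])
    moreover have "P * inverse (y' $ k) = y $ k"
      using P(2) by (simp add: k)
    ultimately have "y $ k \<in> ?G" by metis
    then have "y $ j \<in> ?G" for j using yj[of j] by (cases "j = k") simp_all
    then have "subfield_generated (range (($) y)) \<subseteq> ?G"
      by (intro subfield_generated_least[OF G(1)]) auto
    then show ?thesis using gen by auto
  qed
  ultimately show ?thesis by (simp add: freely_generates_iff)
qed

lemma freely_generates_independent3:
  fixes y :: "'f::field_char_0 ^ 3"
  assumes y: "freely_generates y" and d: "i \<noteq> j" "j \<noteq> k" "i \<noteq> k"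
  shows "independent3 (y $ i) (y $ j) (y $ k)"
proof -
  have alg: "alg_independent y" using y by (simp add: freely_generates_iff)
  have U: "(UNIV :: 3 set) = {i, j, k}"
    using d by (intro card_subset_eq[symmetric]) auto
  have "- {i} = {j, k}" "- {j} = {i, k}" "- {k} = {i, j}"
    unfolding Compl_eq_Diff_UNIV U using d by auto
  then show ?thesis
    using alg_independent_transcendental[OF alg, of i] alg_independent_transcendental[OF alg, of j]
      alg_independent_transcendental[OF alg, of k]
    unfolding independent3_def by simp
qed

section \<open>Relations\<close>

lemma prod_UNIV_4: "prod f (UNIV :: 4 set) = f 1 * f 2 * f 3 * f 4"
  for f :: "4 \<Rightarrow> 'a::comm_monoid_mult"
  unfolding UNIV_4 by (simp add: mult_ac)

lemma prod_UNIV_3: "prod f (UNIV :: 3 set) = f 1 * f 2 * f 3"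
  for f :: "3 \<Rightarrow> 'a::comm_monoid_mult"
  unfolding UNIV_3 by (simp add: mult_ac)

lemma vector_4 [simp]:
  "(vector [x, y, z, t] :: 'a::zero ^ 4) $ 1 = x"
  "(vector [x, y, z, t] :: 'a::zero ^ 4) $ 2 = y"
  "(vector [x, y, z, t] :: 'a::zero ^ 4) $ 3 = z"
  "(vector [x, y, z, t] :: 'a::zero ^ 4) $ 4 = t"
  unfolding vector_def by simp_all

text \<open>The fourth symbol goes to the polynomial variable and the others to constants.
  Evaluation here identifies the ring of integer polynomials on four symbols with
  \<open>D[X]\<close>, \<open>D = Z[x1, x2, x3]\<close>; substituting \<open>M\<close> for
  \<open>X\<close> then yields the original evaluation.\<close>

definition poly_point :: "'f::comm_ring_1 \<Rightarrow> 'f \<Rightarrow> 'f \<Rightarrow> 'f poly ^ 4" where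
  "poly_point x1 x2 x3 = vector [[:x1:], [:x2:], [:x3:], [:0, 1:]]"

lemma poly_eval_poly_point:
  "poly (poly_eval of_int (poly_point x1 x2 x3) p) t = poly_eval of_int (vector [x1, x2, x3, t]) p"
  unfolding poly_eval_def poly_point_def
  by (simp add: poly_sum prod_UNIV_4)

text \<open>Injectivity: each coefficient in the polynomial variable is a relation among
  \<open>x1, x2, x3\<close>.\<close>

lemma poly_eval_poly_point_eq_0:
  fixes x1 x2 x3 :: "'f::field_char_0"
  assumes x: "alg_independent (vector [x1, x2, x3] :: 'f ^ 3)"
    and p: "poly_eval of_int (poly_point x1 x2 x3) p = 0"
  shows "p = 0"
proof -
  \<comment> \<open>\<open>f m\<close> forgets the fourth exponent. That exponent is constant on
    each set \<open>?I\<close> below, so \<open>f\<close> is injective there.\<close>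
  define f where "f m = Poly_Mapping.Abs_poly_mapping (\<lambda>i::3. lookup m (if i = 1 then 1 else if i = 2 then 2 else 3 :: 4))"
    for m :: "4 \<Rightarrow>\<^sub>0 nat"
  have f: "lookup (f m) 1 = lookup m 1" "lookup (f m) 2 = lookup m 2" "lookup (f m) 3 = lookup m 3" for m
    unfolding f_def by simp_all
  define b where "b m = of_int (lookup p m) * (x1 ^ lookup m 1 * x2 ^ lookup m 2 * x3 ^ lookup m 3)" for m
  have mon: "of_int c * ([:x1:] ^ i * [:x2:] ^ j * [:x3:] ^ k * [:0, 1:] ^ l) =
      monom (of_int c * (x1 ^ i * x2 ^ j * x3 ^ k)) l" for c i j k l
    by (simp add: monom_altdef poly_const_pow of_int_poly mult_ac)
  have eval: "poly_eval of_int (poly_point x1 x2 x3) p = (\<Sum>m\<in>keys p. monom (b m) (lookup m 4))"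
    unfolding poly_eval_def poly_point_def b_def prod_UNIV_4 by (simp add: mon)
  show ?thesis
  proof (rule poly_mapping_eqI)
    fix m
    show "lookup p m = lookup 0 m"
    proof (cases "m \<in> keys p")
      case True
      let ?I = "{n \<in> keys p. lookup n 4 = lookup m 4}"
      have "0 = coeff (\<Sum>m\<in>keys p. monom (b m) (lookup m 4)) (lookup m 4)"
        using p eval by simp
      also have "\<dots> = (\<Sum>n\<in>keys p. if lookup n 4 = lookup m 4 then b n else 0)"
        unfolding coeff_sum coeff_monom by (rule sum.cong) auto
      also have "\<dots> = (\<Sum>n\<in>?I. b n)"
        by (simp add: sum.inter_filter)
      also have "\<dots> = (\<Sum>n\<in>?I. of_rat (of_int (lookup p n)) *
          (\<Prod>j\<in>UNIV. (vector [x1, x2, x3] :: 'f ^ 3) $ j ^ lookup (f n) j))"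
        by (simp add: b_def prod_UNIV_3 f)
      finally have "(\<Sum>n\<in>?I. of_rat (of_int (lookup p n)) *
          (\<Prod>j\<in>UNIV. (vector [x1, x2, x3] :: 'f ^ 3) $ j ^ lookup (f n) j)) = 0" by simp
      moreover have "inj_on f ?I"
      proof (rule inj_onI)
        fix n n' assume n: "n \<in> ?I" "n' \<in> ?I" "f n = f n'"
        then have "lookup n i = lookup n' i" for i
          using f[of n] f[of n'] exhaust_4[of i] by auto
        then show "n = n'" by (intro poly_mapping_eqI) auto
      qed
      ultimately have "of_int (lookup p m) = (0 :: rat)"
        using alg_independent_monomials[OF x, of ?I f "\<lambda>n. of_int (lookup p n)" m] True by simp
      then show ?thesis by simp
    qed (simp add: in_keys_iff)
  qed
qed

text \<open>Surjectivity onto \<open>D[X]\<close>, which lets the quotient supplied by Gauss's lemma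
  be lifted back to four symbols.\<close>

lemma polys_subset_poly_eval_range:
  fixes x1 x2 x3 :: "'f::field_char_0"
  shows "polys (subring_generated {x1, x2, x3}) \<subseteq> range (poly_eval of_int (poly_point x1 x2 x3))"
    (is "_ \<subseteq> ?R")
proof
  have R: "is_subring ?R" by (rule of_int_eval.is_subring_poly_eval_range)
  have var: "poly_point x1 x2 x3 $ i \<in> ?R" for i
    by (metis of_int_eval.poly_eval_symb rangeI)
  define C where "C = {c. [:c:] \<in> ?R}"
  have "is_subring C"
    unfolding is_subring_def C_def
  proof (intro conjI ballI CollectI)
    show "[:1:] \<in> ?R" using subring_1[OF R] by (simp add: one_pCons)
    fix u v assume uv: "u \<in> {c. [:c:] \<in> ?R}" "v \<in> {c. [:c:] \<in> ?R}"
    then show "[:u - v:] \<in> ?R" "[:u * v:] \<in> ?R"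
      using subring_diff[OF R, of "[:u:]" "[:v:]"] subring_mult[OF R, of "[:u:]" "[:v:]"]
      by (simp_all add: mult.commute)
  qed
  moreover have "{x1, x2, x3} \<subseteq> C"
    using var[of 1] var[of 2] var[of 3] by (simp add: C_def poly_point_def)
  ultimately have C: "subring_generated {x1, x2, x3} \<subseteq> C"
    by (rule subring_generated_least)
  fix q assume "q \<in> polys (subring_generated {x1, x2, x3})"
  then show "q \<in> ?R"
  proof (induction q)
    case 0
    show ?case by (rule subring_0[OF R])
  next
    case (pCons c q)
    then have "[:c:] \<in> ?R" "q \<in> ?R" using C by (auto simp: polys_pCons C_def)
    moreover have "[:0, 1:] \<in> ?R" using var[of 4] by (simp add: poly_point_def)
    ultimately have "[:c:] + [:0, 1:] * q \<in> ?R"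
      by (intro subring_add[OF R] subring_mult[OF R])
    then show ?case by simp
  qed
qed

lemma ideal_generated_singleton: "ideal_generated {r} = range (\<lambda>q. q * r)"
proof -
  interpret module "(*) :: 'a::comm_ring_1 \<Rightarrow> 'a \<Rightarrow> 'a"
    by unfold_locales (auto simp: algebra_simps)
  show ?thesis by (rule span_singleton)
qed

text \<open>Under the identification with \<open>D[X]\<close> the relation becomes
  \<open>m X - N\<close>, and \<open>p\<close> is a relation iff its image vanishes at
  \<open>N / m\<close>, which Gauss's lemma turns into divisibility.\<close>

lemma markov_relation_ideal:
  fixes x1 x2 x3 M :: "'f::field_char_0"
  assumes a: "a > 0" and x: "freely_generates (vector [x1, x2, x3] :: 'f ^ 3)"
    and M: "M = (x1 ^ a + x2 ^ a + x3 ^ a) / (x1 * x2 * x3)"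
  shows "relation_ideal (vector [x1, x2, x3, M] :: 'f ^ 4) =
    ideal_generated {symb 1 * symb 2 * symb 3 * symb 4 - symb 1 ^ a - symb 2 ^ a - symb 3 ^ a}"
proof -
  define rel :: "(4, int) poly_ring" where
    "rel = symb 1 * symb 2 * symb 3 * symb 4 - symb 1 ^ a - symb 2 ^ a - symb 3 ^ a"
  let ?\<Phi> = "poly_eval of_int (poly_point x1 x2 x3)"
  define D where "D = subring_generated {x1, x2, x3}"
  have D: "is_subring D" unfolding D_def by (rule is_subring_generated)
  have vars: "x1 \<in> D" "x2 \<in> D" "x3 \<in> D"
    unfolding D_def using subring_generated_superset[of "{x1, x2, x3}"] by auto
  have i: "independent3 x1 x2 x3"
    using freely_generates_independent3[OF x, of 1 2 3] by simp
  note nz = independent3_neq_0[OF i]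
  define m where "m = x1 * x2 * x3"
  define N where "N = x1 ^ a + x2 ^ a + x3 ^ a"
  have mN: "m \<in> D" "N \<in> D" "m \<noteq> 0"
    unfolding m_def N_def using nz
    by (auto intro!: subring_mult[OF D] subring_add[OF D] subring_power[OF D] vars)
  have M': "M = N / m" by (simp add: M N_def m_def)
  have rel: "?\<Phi> rel = [:- N, m:]"
    unfolding rel_def poly_point_def N_def m_def
    by (simp add: of_int_eval.poly_eval_diff of_int_eval.poly_eval_mult of_int_eval.poly_eval_power
        of_int_eval.poly_eval_symb poly_const_pow)
  have eval: "poly_eval of_int (vector [x1, x2, x3, M] :: 'f ^ 4) p = poly (?\<Phi> p) M" for p
    by (simp add: poly_eval_poly_point)
  have "p \<in> relation_ideal (vector [x1, x2, x3, M] :: 'f ^ 4) \<longleftrightarrow> p \<in> range (\<lambda>q. q * rel)" for p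
  proof
    assume "p \<in> range (\<lambda>q. q * rel)"
    moreover have "poly_eval of_int (vector [x1, x2, x3, M] :: 'f ^ 4) rel = 0"
      unfolding eval rel using mN by (simp add: M')
    ultimately show "p \<in> relation_ideal (vector [x1, x2, x3, M] :: 'f ^ 4)"
      by (auto simp: relation_ideal_def of_int_eval.poly_eval_mult)
  next
    assume "p \<in> relation_ideal (vector [x1, x2, x3, M] :: 'f ^ 4)"
    then have "poly (?\<Phi> p) (N / m) = 0" by (simp add: relation_ideal_def eval flip: M')
    moreover have "?\<Phi> p \<in> polys D"
    proof -
      note PR = is_subring_polys[OF D]
      have "poly_point x1 x2 x3 $ i \<in> polys D" for i
        using exhaust_4[of i] vars subring_0[OF PR] subring_0[OF D] subring_1[OF D]
        by (auto simp: poly_point_def polys_pCons)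
      then show ?thesis
        unfolding poly_eval_def
        by (intro subring_sum[OF PR] subring_mult[OF PR] subring_of_int[OF PR] subring_prod[OF PR]
            subring_power[OF PR])
    qed
    ultimately obtain q where q: "q \<in> polys D" "?\<Phi> p = [:- N, m:] * q"
      using linear_factor_coprime[OF D mN, of "?\<Phi> p"] markov_coprime[OF i a, folded D_def m_def N_def]
      by blast
    obtain q' where "q = ?\<Phi> q'"
      using q(1) polys_subset_poly_eval_range unfolding D_def by blast
    then have "?\<Phi> (p - q' * rel) = 0"
      using q(2) by (simp add: of_int_eval.poly_eval_diff of_int_eval.poly_eval_mult rel mult.commute
        del: mult_pCons_left mult_pCons_right)
    then have "p - q' * rel = 0"
      using poly_eval_poly_point_eq_0[of x1 x2 x3 "p - q' * rel"] x
      unfolding freely_generates_iff by blast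
    then show "p \<in> range (\<lambda>q. q * rel)" by auto
  qed
  then show ?thesis
    unfolding ideal_generated_singleton rel_def[symmetric] by blast
qed

section \<open>Mutation of cyclic seeds\<close>

lemma UNIV_3_distinct:
  assumes "i \<noteq> j" "j \<noteq> k" "i \<noteq> k"
  shows "(UNIV :: 3 set) = {i, j, k}"
  using assms by (intro card_subset_eq[symmetric]) auto

text \<open>The mutation-cyclic matrices: the three entries have a common sign along the cycle
  \<open>1 \<rightarrow> 2 \<rightarrow> 3 \<rightarrow> 1\<close>, and the Markov constant, which is invariant under mutation, is at most 4.\<close>

definition cyclic_matrix :: "int ^ 3 ^ 3 \<Rightarrow> bool" where
  "cyclic_matrix B \<longleftrightarrow> transpose B = - B \<and>
     (\<exists>s p q r. (s = 1 \<or> s = -1) \<and> p \<ge> 2 \<and> q \<ge> 2 \<and> r \<ge> 2 \<and>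
        p\<^sup>2 + q\<^sup>2 + r\<^sup>2 - p * q * r \<le> 4 \<and>
        B $ 1 $ 2 = s * p \<and> B $ 2 $ 3 = s * q \<and> B $ 3 $ 1 = s * r)"

lemma skew_entry:
  fixes B :: "int ^ 'n ^ 'n"
  assumes "transpose B = - B" shows "B $ i $ j = - B $ j $ i"
proof -
  have "transpose B $ j $ i = (- B) $ j $ i" using assms by simp
  then show ?thesis by (simp add: transpose_def)
qed

lemma skew_diag:
  fixes B :: "int ^ 'n ^ 'n"
  assumes "transpose B = - B" shows "B $ i $ i = 0"
  using skew_entry[OF assms, of i i] by simp

text \<open>The sign pattern may be read along any ordering of the indices: even permutations rotate
  \<open>p, q, r\<close>, odd ones reverse the cycle and so replace \<open>s\<close> by
  \<open>- s\<close>.\<close>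

lemma cyclic_matrixE:
  assumes B: "cyclic_matrix B" and d: "i \<noteq> j" "j \<noteq> k" "i \<noteq> k"
  obtains s p q r where "s = 1 \<or> s = -1" "p \<ge> 2" "q \<ge> 2" "r \<ge> 2"
    "p\<^sup>2 + q\<^sup>2 + r\<^sup>2 - p * q * r \<le> 4"
    "B $ i $ j = s * p" "B $ j $ k = s * q" "B $ k $ i = s * r"
    "B $ j $ i = - (s * p)" "B $ k $ j = - (s * q)" "B $ i $ k = - (s * r)"
proof -
  have sk: "transpose B = - B" using B by (simp add: cyclic_matrix_def)
  obtain s p q r where *: "s = 1 \<or> s = -1" "p \<ge> 2" "q \<ge> 2" "r \<ge> 2"
    "p\<^sup>2 + q\<^sup>2 + r\<^sup>2 - p * q * r \<le> 4"
    "B $ 1 $ 2 = s * p" "B $ 2 $ 3 = s * q" "B $ 3 $ 1 = s * r"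
    using B unfolding cyclic_matrix_def by blast
  have **: "B $ 2 $ 1 = - (s * p)" "B $ 3 $ 2 = - (s * q)" "B $ 1 $ 3 = - (s * r)"
    using * skew_entry[OF sk] by metis+
  note that1 = that[of s p q r] that[of s q r p] that[of s r p q]
    that[of "- s" p r q] that[of "- s" q p r] that[of "- s" r q p]
  consider "i = 1 \<and> j = 2 \<and> k = 3" | "i = 2 \<and> j = 3 \<and> k = 1" | "i = 3 \<and> j = 1 \<and> k = 2"
    | "i = 2 \<and> j = 1 \<and> k = 3" | "i = 3 \<and> j = 2 \<and> k = 1" | "i = 1 \<and> j = 3 \<and> k = 2"
    using d exhaust_3[of i] exhaust_3[of j] exhaust_3[of k] by blast
  then show ?thesis
    by cases (use * ** in \<open>auto simp: algebra_simps intro: that1\<close>)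
qed

lemma cyclic_matrixI:
  assumes sk: "transpose B = - B" and d: "i \<noteq> j" "j \<noteq> k" "i \<noteq> k"
    and *: "s = 1 \<or> s = -1" "p \<ge> 2" "q \<ge> 2" "r \<ge> 2"
      "p\<^sup>2 + q\<^sup>2 + r\<^sup>2 - p * q * r \<le> 4"
      "B $ i $ j = s * p" "B $ j $ k = s * q" "B $ k $ i = s * r"
  shows "cyclic_matrix B"
proof -
  have **: "B $ j $ i = - s * p" "B $ k $ j = - s * q" "B $ i $ k = - s * r"
    using * skew_entry[OF sk] by (metis mult_minus_left)+
  have s: "- s = 1 \<or> - s = -1" using *(1) by auto
  have c: "q\<^sup>2 + r\<^sup>2 + p\<^sup>2 - q * r * p \<le> 4" "r\<^sup>2 + p\<^sup>2 + q\<^sup>2 - r * p * q \<le> 4"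
    "p\<^sup>2 + r\<^sup>2 + q\<^sup>2 - p * r * q \<le> 4" "q\<^sup>2 + p\<^sup>2 + r\<^sup>2 - q * p * r \<le> 4" "r\<^sup>2 + q\<^sup>2 + p\<^sup>2 - r * q * p \<le> 4"
    using *(5) by (simp_all add: algebra_simps)
  have I: "cyclic_matrix B"
    if "s' = 1 \<or> s' = -1" "p' \<ge> 2" "q' \<ge> 2" "r' \<ge> 2" "p'\<^sup>2 + q'\<^sup>2 + r'\<^sup>2 - p' * q' * r' \<le> 4"
      "B $ 1 $ 2 = s' * p'" "B $ 2 $ 3 = s' * q'" "B $ 3 $ 1 = s' * r'" for s' p' q' r'
    unfolding cyclic_matrix_def using sk that by blast
  consider "i = 1 \<and> j = 2 \<and> k = 3" | "i = 2 \<and> j = 3 \<and> k = 1" | "i = 3 \<and> j = 1 \<and> k = 2"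
    | "i = 2 \<and> j = 1 \<and> k = 3" | "i = 3 \<and> j = 2 \<and> k = 1" | "i = 1 \<and> j = 3 \<and> k = 2"
    using d exhaust_3[of i] exhaust_3[of j] exhaust_3[of k] by blast
  then show ?thesis
  proof cases
    case 1 then show ?thesis using I[of s p q r] * by simp
  next
    case 2 then show ?thesis using I[of s r p q] * c by simp
  next
    case 3 then show ?thesis using I[of s q r p] * c by simp
  next
    case 4 then show ?thesis using I[of "- s" p r q] * ** s c by simp
  next
    case 5 then show ?thesis using I[of "- s" q p r] * ** s c by simp
  next
    case 6 then show ?thesis using I[of "- s" r q p] * ** s c by simp
  qed
qed

text \<open>\<open>t = q r - p\<close> is the other root of the Markov equation in \<open>p\<close>.
  The bound gives \<open>p t >= q^2 + r^2 - 4 > 0\<close>, so \<open>t > 0\<close>; and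
  \<open>t = 1\<close> would give \<open>q r - 1 >= 2 q r - 4\<close>, contrary to
  \<open>q r >= 4\<close>.\<close>

lemma markov_descent_bound:
  fixes p q r :: int
  assumes "p \<ge> 2" "q \<ge> 2" "r \<ge> 2" "p\<^sup>2 + q\<^sup>2 + r\<^sup>2 - p * q * r \<le> 4"
  shows "q * r - p \<ge> 2"
proof (rule ccontr)
  define t where "t = q * r - p"
  assume "\<not> q * r - p \<ge> 2"
  then have t: "t \<le> 1" by (simp add: t_def)
  have q2: "q\<^sup>2 \<ge> 4" "r\<^sup>2 \<ge> 4"
    using power_mono[of 2 q 2] power_mono[of 2 r 2] assms by auto
  have qr: "q * r \<ge> 4" using mult_mono[of 2 q 2 r] assms by auto
  have "p\<^sup>2 - p * q * r = - (p * t)" by (simp add: t_def power2_eq_square algebra_simps)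
  then have pt: "p * t \<ge> q\<^sup>2 + r\<^sup>2 - 4" using assms(4) by linarith
  then have "p * t > 0" using q2 by linarith
  then have "t > 0" using assms(1) by (simp add: zero_less_mult_iff)
  then have "t = 1" using t by linarith
  then have "q * r - 1 \<ge> q\<^sup>2 + r\<^sup>2 - 4" using pt by (simp add: t_def)
  moreover have "(q - r)\<^sup>2 \<ge> 0" by simp
  then have "q\<^sup>2 + r\<^sup>2 \<ge> 2 * (q * r)" by (simp add: power2_eq_square algebra_simps)
  ultimately show False using qr by linarith
qed

lemma mutate_matrix_entry:
  assumes "i \<noteq> k" "j \<noteq> k"
  shows "mutate_matrix k B $ i $ j = B $ i $ j +
    (if B $ i $ k > 0 \<and> B $ k $ j > 0 then B $ i $ k * B $ k $ j
     else if B $ i $ k < 0 \<and> B $ k $ j < 0 then - (B $ i $ k * B $ k $ j) else 0)"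
proof -
  have "\<bar>x\<bar> * y + x * \<bar>y\<bar> =
      2 * (if x > 0 \<and> y > 0 then x * y else if x < 0 \<and> y < 0 then - (x * y) else 0)" for x y :: int
    by (auto simp: abs_if not_less le_less)
  then show ?thesis using assms by (simp add: mutate_matrix_def)
qed

lemma mutate_matrix_entry_k:
  "mutate_matrix k B $ k $ j = - B $ k $ j" "mutate_matrix k B $ i $ k = - B $ i $ k"
  by (simp_all add: mutate_matrix_def)

lemma mutate_matrix_skew:
  fixes B :: "int ^ 'n::finite ^ 'n"
  assumes "transpose B = - B" shows "transpose (mutate_matrix k B) = - mutate_matrix k B"
proof -
  note sk = skew_entry[OF assms]
  have entry: "mutate_matrix k B $ j $ i = - mutate_matrix k B $ i $ j" for i j
  proof (cases "i = k \<or> j = k")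
    case True
    then have "mutate_matrix k B $ j $ i = - B $ j $ i" "mutate_matrix k B $ i $ j = - B $ i $ j"
      by (auto simp: mutate_matrix_def)
    then show ?thesis using sk[of i j] by linarith
  next
    case False
    then show ?thesis
      using sk[of i j] sk[of i k] sk[of k j] by (auto simp: mutate_matrix_entry)
  qed
  show ?thesis
    by (auto simp: vec_eq_iff transpose_def intro: entry)
qed

section \<open>Involutivity of mutation and compatibility with permutations\<close>

lemma mutate_matrix_involution:
  fixes B :: "int ^ 'n::finite ^ 'n"
  shows "mutate_matrix k (mutate_matrix k B) = B"
proof -
  have "mutate_matrix k (mutate_matrix k B) $ i $ j = B $ i $ j" for i j
    by (cases "i = k \<or> j = k") (auto simp: mutate_matrix_entry_k mutate_matrix_entry)
  then show ?thesis by (simp add: vec_eq_iff)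
qed

text \<open>Mutation negates column \<open>k\<close>, which only swaps the two products of the
  exchange relation; \<open>x $ k\<close> occurs in neither because
  \<open>B $ k $ k = 0\<close>.\<close>

lemma mutate_vars_involution:
  fixes x :: "'f::field ^ 'n::finite"
  assumes sk: "transpose B = - B" and nz: "mutate_vars k x B $ k \<noteq> 0"
  shows "mutate_vars k (mutate_vars k x B) (mutate_matrix k B) = x"
proof -
  let ?x = "mutate_vars k x B" and ?B = "mutate_matrix k B"
  have x: "?x $ j = x $ j" if "j \<noteq> k" for j using that by (simp add: mutate_vars_def)
  have kk: "B $ k $ k = 0" by (rule skew_diag[OF sk])
  have xB: "?x $ j = x $ j" if "B $ j $ k \<noteq> 0" for j
    using that kk x[of j] by (cases "j = k") auto
  have B: "?B $ j $ k = - B $ j $ k" for j by (rule mutate_matrix_entry_k)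
  define A where "A = (\<Prod>j | B $ j $ k > 0. x $ j ^ nat (B $ j $ k))"
  define C where "C = (\<Prod>j | B $ j $ k < 0. x $ j ^ nat (- B $ j $ k))"
  have xk: "?x $ k = (A + C) * inverse (x $ k)"
    by (simp add: mutate_vars_def A_def C_def)
  have "(\<Prod>j | ?B $ j $ k > 0. ?x $ j ^ nat (?B $ j $ k)) = C"
    unfolding C_def B by (rule prod.cong) (auto simp: xB)
  moreover have "(\<Prod>j | ?B $ j $ k < 0. ?x $ j ^ nat (- ?B $ j $ k)) = A"
    unfolding A_def B by (rule prod.cong) (auto simp: xB)
  ultimately have "mutate_vars k ?x ?B $ k = (C + A) * inverse (?x $ k)"
    by (simp add: mutate_vars_def)
  also have "\<dots> = x $ k" using nz unfolding xk by (auto simp: field_simps)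
  finally show ?thesis
    using x by (auto simp: vec_eq_iff mutate_vars_def)
qed

lemma freely_generates_neq_0:
  fixes x :: "'f::field_char_0 ^ 'n::finite"
  assumes "freely_generates x" shows "x $ i \<noteq> 0"
  using alg_independent_transcendental[of x i] assms
    transcendental_neq_0[OF is_subfield_subring[OF is_subfield_generated]]
  by (auto simp: freely_generates_iff)

lemma mutate_involution:
  fixes s :: "('f::field_char_0, 'n::finite) seed"
  assumes "is_seed s" "is_seed (mutate k s)"
  shows "mutate k (mutate k s) = s"
proof -
  have "mutate_vars k (fst s) (snd s) $ k \<noteq> 0"
    using freely_generates_neq_0 assms(2) by (auto simp: is_seed_def mutate_def)
  then show ?thesis
    using assms(1) by (simp add: mutate_def mutate_vars_involution mutate_matrix_involution is_seed_def)
qed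

lemma permute_seed_inverse:
  assumes "bij p" shows "permute_seed (inv p) (permute_seed p s) = s"
  using surj_f_inv_f[OF bij_is_surj[OF assms]]
  by (simp add: permute_seed_def vec_eq_iff prod_eq_iff)

lemma mutate_vars_permute:
  fixes x :: "'f::field ^ 'n::finite"
  assumes p: "bij p"
  shows "mutate_vars k (\<chi> i. x $ p i) (\<chi> i j. B $ p i $ p j) = (\<chi> i. mutate_vars (p k) x B $ p i)"
proof -
  have "(\<Prod>j | P (p j). f (p j)) = (\<Prod>j | P j. f j)" for P and f :: "'n \<Rightarrow> 'f"
  proof (rule prod.reindex_bij_betw, rule bij_betw_imageI)
    show "inj_on p {j. P (p j)}" using bij_is_inj[OF p] by (rule inj_on_subset) simp
    show "p ` {j. P (p j)} = {j. P j}"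
    proof (intro equalityI subsetI)
      fix l assume "l \<in> {j. P j}"
      then have "p (inv p l) = l" "P l" using surj_f_inv_f[OF bij_is_surj[OF p]] by auto
      then show "l \<in> p ` {j. P (p j)}" by (metis imageI mem_Collect_eq)
    qed auto
  qed
  note reindex = this[of "\<lambda>j. x $ j ^ nat (B $ j $ p k)" "\<lambda>j. B $ j $ p k > 0"]
    this[of "\<lambda>j. x $ j ^ nat (- (B $ j $ p k))" "\<lambda>j. B $ j $ p k < 0"]
  show ?thesis
    using p by (auto simp: mutate_vars_def vec_eq_iff reindex bij_is_inj inj_eq)
qed

text \<open>In a cyclic matrix the two off-diagonal entries of column \<open>k\<close> have opposite
  signs, so each product in the exchange relation is a power of a single variable.\<close>

lemma mutate_vars_cyclic:
  assumes B: "cyclic_matrix B" and d: "i \<noteq> j" "j \<noteq> k" "i \<noteq> k"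
  shows "mutate_vars k x B $ k = (x $ i ^ nat \<bar>B $ i $ k\<bar> + x $ j ^ nat \<bar>B $ j $ k\<bar>) / x $ k"
    and "mutate_vars k x B $ i = x $ i" "mutate_vars k x B $ j = x $ j"
proof -
  obtain s p q r where *: "s = 1 \<or> s = (-1 :: int)" "p \<ge> 2" "q \<ge> 2" "r \<ge> 2"
    "p\<^sup>2 + q\<^sup>2 + r\<^sup>2 - p * q * r \<le> 4"
    "B $ i $ j = s * p" "B $ j $ k = s * q" "B $ k $ i = s * r"
    "B $ j $ i = - (s * p)" "B $ k $ j = - (s * q)" "B $ i $ k = - (s * r)"
    by (rule cyclic_matrixE[OF B d])
  have kk: "B $ k $ k = 0" using B skew_diag by (auto simp: cyclic_matrix_def)
  have U: "{l. P l} = (if P i then {i} else {}) \<union> (if P j then {j} else {}) \<union> (if P k then {k} else {})"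
    for P :: "3 \<Rightarrow> bool"
  proof -
    have "{l. P l} = {l \<in> {i, j, k}. P l}" using UNIV_3_distinct[OF d] by blast
    then show ?thesis by auto
  qed
  show "mutate_vars k x B $ k = (x $ i ^ nat \<bar>B $ i $ k\<bar> + x $ j ^ nat \<bar>B $ j $ k\<bar>) / x $ k"
    using *(1)
  proof
    assume s: "s = 1"
    have "{l. B $ l $ k > 0} = {j}" "{l. B $ l $ k < 0} = {i}"
      unfolding U using * s kk by auto
    then show ?thesis using * s by (simp add: mutate_vars_def divide_inverse add.commute)
  next
    assume s: "s = -1"
    have "{l. B $ l $ k > 0} = {i}" "{l. B $ l $ k < 0} = {j}"
      unfolding U using * s kk by auto
    then show ?thesis using * s by (simp add: mutate_vars_def divide_inverse add.commute)
  qed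
  show "mutate_vars k x B $ i = x $ i" "mutate_vars k x B $ j = x $ j"
    using d by (simp_all add: mutate_vars_def)
qed

text \<open>The entry opposite to \<open>k\<close> changes from \<open>s p\<close> to
  \<open>- s (q r - p)\<close>, a root exchange that preserves the Markov constant. The second claim
  supplies \<open>d + e = b c\<close> for \<open>laurent_exchange_step\<close>.\<close>

lemma cyclic_matrix_mutate:
  assumes B: "cyclic_matrix B" and d: "i \<noteq> j" "j \<noteq> k" "i \<noteq> k"
  shows "cyclic_matrix (mutate_matrix k B)"
    and "\<bar>mutate_matrix k B $ i $ j\<bar> + \<bar>B $ i $ j\<bar> = \<bar>B $ i $ k\<bar> * \<bar>B $ j $ k\<bar>"
proof -
  obtain s p q r where *: "s = 1 \<or> s = (-1 :: int)" "p \<ge> 2" "q \<ge> 2" "r \<ge> 2"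
    "p\<^sup>2 + q\<^sup>2 + r\<^sup>2 - p * q * r \<le> 4"
    "B $ i $ j = s * p" "B $ j $ k = s * q" "B $ k $ i = s * r"
    "B $ j $ i = - (s * p)" "B $ k $ j = - (s * q)" "B $ i $ k = - (s * r)"
    by (rule cyclic_matrixE[OF B d])
  have p': "q * r - p \<ge> 2" by (rule markov_descent_bound[OF *(2-5)])
  have ij: "mutate_matrix k B $ i $ j = - s * (q * r - p)"
    using *(1) *(2-4) d by (auto simp: mutate_matrix_entry *(6-11) algebra_simps)
  have markov: "(q * r - p)\<^sup>2 + q\<^sup>2 + r\<^sup>2 - (q * r - p) * q * r \<le> 4"
    using *(5) by (simp add: power2_eq_square algebra_simps)
  have sk: "transpose B = - B" using B by (simp add: cyclic_matrix_def)
  show "cyclic_matrix (mutate_matrix k B)"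
  proof (rule cyclic_matrixI[OF mutate_matrix_skew[OF sk] d _ p' *(3,4) markov ij])
    show "- s = 1 \<or> - s = -1" using *(1) by auto
    show "mutate_matrix k B $ j $ k = - s * q" "mutate_matrix k B $ k $ i = - s * r"
      by (simp_all add: mutate_matrix_entry_k *)
  qed
  show "\<bar>mutate_matrix k B $ i $ j\<bar> + \<bar>B $ i $ j\<bar> = \<bar>B $ i $ k\<bar> * \<bar>B $ j $ k\<bar>"
    using *(1) *(2-4) p' by (auto simp: ij *(6-11) abs_mult mult.commute)
qed

section \<open>Laurent membership along a mutation class\<close>

lemma range_vec_3:
  fixes y :: "'a ^ 3"
  assumes "i \<noteq> j" "j \<noteq> k" "i \<noteq> k" shows "range (($) y) = {y $ i, y $ j, y $ k}"
  unfolding UNIV_3_distinct[OF assms] by simp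

lemma is_seed_mutate:
  fixes s :: "('f::field_char_0, 3) seed"
  assumes s: "is_seed s" and B: "cyclic_matrix (snd s)" and d: "i \<noteq> j" "j \<noteq> k" "i \<noteq> k"
  shows "is_seed (mutate k s)"
proof -
  define x where "x = fst s"
  define C where "C = snd s"
  have x: "freely_generates x" and sk: "transpose C = - C"
    using s by (simp_all add: is_seed_def x_def C_def)
  define P where "P = x $ i ^ nat \<bar>C $ i $ k\<bar> + x $ j ^ nat \<bar>C $ j $ k\<bar>"
  note mut = mutate_vars_cyclic[OF B[folded C_def] d, of x]
  have K: "- {k} = {i, j}" unfolding Compl_eq_Diff_UNIV UNIV_3_distinct[OF d] using d by auto
  note F = is_subfield_subring[OF is_subfield_generated, of "{x $ i, x $ j}"]
  have "P \<in> subfield_generated (($) x ` (- {k}))"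
    unfolding K P_def using subfield_generated_superset[of "{x $ i, x $ j}"]
    by (auto intro!: subring_add[OF F] subring_power[OF F])
  moreover have "P \<noteq> 0"
  proof -
    have "nat \<bar>C $ i $ k\<bar> > 0"
      by (rule cyclic_matrixE[OF B[folded C_def] d]) (auto simp: abs_mult)
    then show ?thesis
      unfolding P_def
      by (rule independent3_power_sum_neq_0[OF freely_generates_independent3[OF x d]])
  qed
  moreover have "mutate_vars k x C $ l = x $ l" if "l \<noteq> k" for l
    using that by (simp add: mutate_vars_def)
  ultimately have "freely_generates (mutate_vars k x C)"
    using freely_generates_exchange[OF x _ mut(1)[folded P_def]] by blast
  then show ?thesis
    using mutate_matrix_skew[OF sk] by (simp add: is_seed_def mutate_def x_def C_def)
qed

text \<open>The induction invariant. The neighbours are included because passing to a neighbour of a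
  neighbour requires membership in three Laurent rings at once.\<close>

definition laurent_star :: "'f::field_char_0 set \<Rightarrow> ('f, 3) seed \<Rightarrow> bool" where
  "laurent_star R s \<longleftrightarrow> is_seed s \<and> cyclic_matrix (snd s) \<and>
     R \<subseteq> laurent_ring (range (($) (fst s))) \<and>
     (\<forall>k. R \<subseteq> laurent_ring (range (($) (fst (mutate k s)))))"

lemma ex_distinct_3:
  fixes k :: 3
  obtains i j where "i \<noteq> j" "j \<noteq> k" "i \<noteq> k"
proof -
  have "(1 :: 3) \<noteq> 2" "(2 :: 3) \<noteq> 3" "(1 :: 3) \<noteq> 3" by simp_all
  then show ?thesis using that exhaust_3[of k] by metis
qed

text \<open>Mutating at \<open>k\<close> again returns to \<open>s\<close>. For \<open>l\<close>
  different from \<open>k\<close>, \<open>laurent_exchange_step\<close> applies with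
  \<open>u\<close>, \<open>v\<close>, \<open>w\<close> the variables at \<open>k\<close>,
  \<open>l\<close> and the third index \<open>m\<close>.\<close>

lemma laurent_star_mutate:
  fixes s :: "('f::field_char_0, 3) seed"
  assumes s: "laurent_star R s" and m: "is_seed (mutate k s)"
  shows "laurent_star R (mutate k s)"
proof -
  define x where "x = fst s"
  define B where "B = snd s"
  define x' where "x' = mutate_vars k x B"
  define B' where "B' = mutate_matrix k B"
  have ms: "mutate k s = (x', B')" by (simp add: mutate_def x_def B_def x'_def B'_def)
  have seed: "is_seed s" and B: "cyclic_matrix B"
    and R: "R \<subseteq> laurent_ring (range (($) x))" "\<And>l. R \<subseteq> laurent_ring (range (($) (mutate_vars l x B)))"
    using s by (auto simp: laurent_star_def x_def B_def mutate_def)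
  have x: "freely_generates x" using seed by (simp add: is_seed_def x_def)
  have x': "freely_generates x'" using m by (simp add: is_seed_def ms)
  have B': "cyclic_matrix B'"
    unfolding B'_def by (rule ex_distinct_3[of k]) (rule cyclic_matrix_mutate(1)[OF B])
  have "R \<subseteq> laurent_ring (range (($) (mutate_vars l x' B')))" for l
  proof (cases "l = k")
    case True
    have "mutate k (mutate k s) = s" by (rule mutate_involution[OF seed m])
    then have "mutate_vars k x' B' = x" unfolding ms by (auto simp: mutate_def x_def)
    then show ?thesis using R(1) True by simp
  next
    case False
    have "card {k, l} < card (UNIV :: 3 set)" using False by simp
    then have "{k, l} \<noteq> UNIV" by force
    then obtain m where m: "m \<noteq> k" "m \<noteq> l" by blast
    have d1: "l \<noteq> m" "m \<noteq> k" "l \<noteq> k" and d2: "k \<noteq> m" "m \<noteq> l" "k \<noteq> l"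
      using False m by auto
    note mk = mutate_vars_cyclic[OF B d1, of x, folded x'_def]
    note ml = mutate_vars_cyclic[OF B d2, of x]
    note ml' = mutate_vars_cyclic[OF B' d2, of x']
    have sk: "B $ i $ j = - B $ j $ i" for i j
      using B skew_entry by (auto simp: cyclic_matrix_def)
    have abs: "\<bar>B $ i $ j\<bar> = \<bar>B $ j $ i\<bar>" for i j using sk[of i j] by simp
    define b where "b = nat \<bar>B $ k $ l\<bar>"
    define c where "c = nat \<bar>B $ m $ k\<bar>"
    define d where "d = nat \<bar>B $ m $ l\<bar>"
    define e where "e = nat \<bar>B' $ m $ l\<bar>"
    have b: "nat \<bar>B $ k $ l\<bar> = b" "nat \<bar>B $ l $ k\<bar> = b" "nat \<bar>B' $ k $ l\<bar> = b"
      unfolding b_def B'_def mutate_matrix_entry_k using abs[of k l] by simp_all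
    have b0: "b > 0"
      unfolding b_def by (rule cyclic_matrixE[OF B d2]) (auto simp: abs_mult)
    have "\<bar>B' $ m $ l\<bar> + \<bar>B $ m $ l\<bar> = \<bar>B $ m $ k\<bar> * \<bar>B $ l $ k\<bar>"
      unfolding B'_def by (rule cyclic_matrix_mutate(2)[OF B]) (use d1 in auto)
    then have "int (d + e) = int (b * c)"
      using abs[of l k] by (simp add: b_def c_def d_def e_def mult.commute)
    then have de: "d + e = b * c" by linarith
    define u where "u = x $ k"
    define v where "v = x $ l"
    define w where "w = x $ m"
    have i: "independent3 u v w"
      unfolding u_def v_def w_def by (rule freely_generates_independent3[OF x]) (use d2 in auto)
    define u' where "u' = (v ^ b + w ^ c) / u"
    define v' where "v' = (u ^ b + w ^ d) / v"
    define v'' where "v'' = (u' ^ b + w ^ e) / v"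
    have range_eq: "range (($) y) = {y $ k, y $ l, y $ m}" for y :: "'f ^ 3"
      by (rule range_vec_3) (use d2 in auto)
    have x'_eq: "x' $ k = u'" "x' $ l = v" "x' $ m = w"
      using mk by (simp_all add: u'_def u_def v_def w_def b c_def)
    have "range (($) x) = {u, v, w}" "range (($) x') = {u', v, w}"
      unfolding range_eq x'_eq by (simp_all add: u_def v_def w_def)
    moreover have "range (($) (mutate_vars l x B)) = {u, v', w}"
      unfolding range_eq using ml by (simp add: u_def v_def w_def v'_def b d_def)
    moreover have "range (($) (mutate_vars l x' B')) = {u', v'', w}"
      unfolding range_eq using ml' by (simp add: x'_eq v''_def b e_def)
    moreover have "f \<in> laurent_ring {u', v'', w}"
      if "f \<in> laurent_ring {u, v, w}" "f \<in> laurent_ring {u', v, w}" "f \<in> laurent_ring {u, v', w}" for f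
      using laurent_exchange_step[OF _ _ independent3_neq_0(3)[OF i] b0 de u'_def v'_def v''_def that] i
      by (simp add: independent3_def)
    ultimately show ?thesis
      using R(1) R(2)[of k] R(2)[of l] unfolding x'_def[symmetric] by (simp only:) blast
  qed
  moreover have "R \<subseteq> laurent_ring (range (($) x'))" using R(2)[of k] by (simp add: x'_def)
  ultimately show ?thesis
    using m B' unfolding laurent_star_def ms by (simp add: mutate_def)
qed

lemma cyclic_matrix_permute:
  fixes p :: "3 \<Rightarrow> 3"
  assumes B: "cyclic_matrix B" and p: "bij p"
  shows "cyclic_matrix (\<chi> i j. B $ p i $ p j)"
proof -
  have d: "p 1 \<noteq> p 2" "p 2 \<noteq> p 3" "p 1 \<noteq> p 3"
    using bij_is_inj[OF p] by (simp_all add: inj_eq)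
  have "transpose B = - B" using B by (simp add: cyclic_matrix_def)
  then have sk: "B $ i $ j = - B $ j $ i" for i j by (rule skew_entry)
  have sk': "transpose (\<chi> i j. B $ p i $ p j) = - (\<chi> i j. B $ p i $ p j)"
    by (auto simp: vec_eq_iff transpose_def intro: sk)
  show ?thesis
  proof (rule cyclic_matrixE[OF B d])
    fix s t q r :: int
    assume "s = 1 \<or> s = -1" "t \<ge> 2" "q \<ge> 2" "r \<ge> 2" "t\<^sup>2 + q\<^sup>2 + r\<^sup>2 - t * q * r \<le> 4"
      "B $ p 1 $ p 2 = s * t" "B $ p 2 $ p 3 = s * q" "B $ p 3 $ p 1 = s * r"
    then show ?thesis
      by (intro cyclic_matrixI[OF sk', of 1 2 3 s t q r]) simp_all
  qed
qed

text \<open>Relabelling does not change a cluster as a set, and it commutes with mutation up to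
  renaming the index.\<close>

lemma laurent_star_permute:
  fixes s :: "('f::field_char_0, 3) seed"
  assumes s: "laurent_star R s" and p: "bij p" and seed: "is_seed (permute_seed p s)"
  shows "laurent_star R (permute_seed p s)"
proof -
  have range_eq: "range (($) (\<chi> i. y $ p i)) = range (($) y)" for y :: "'f ^ 3"
  proof -
    have "range (($) (\<chi> i. y $ p i)) = ($) y ` range p" by (auto simp: image_iff)
    then show ?thesis using bij_is_surj[OF p] by simp
  qed
  show ?thesis
    using s seed cyclic_matrix_permute[OF _ p]
    unfolding laurent_star_def permute_seed_def mutate_def fst_conv snd_conv mutate_vars_permute[OF p] range_eq
    by blast
qed

text \<open>The equivalence closure also runs steps backwards; a reversed step is again a mutation
  at the same index or the inverse permutation.\<close>

lemma laurent_star_equivalent: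
  fixes s t :: "('f::field_char_0, 3) seed"
  assumes "mutation_equivalent s t" "laurent_star R s"
  shows "laurent_star R t"
  using assms unfolding mutation_equivalent_def
proof (induction rule: equivclp_induct)
  case (step t u)
  then have t: "laurent_star R t" by blast
  consider "seed_step t u" | "seed_step u t" using step.hyps by blast
  then show ?case
  proof cases
    case 1
    then show ?thesis
      using laurent_star_mutate[OF t] laurent_star_permute[OF t] unfolding seed_step_def by blast
  next
    case 2
    then have seeds: "is_seed u" "is_seed t" by (simp_all add: seed_step_def)
    consider k where "t = mutate k u" | p where "bij p" "t = permute_seed p u"
      using 2 by (auto simp: seed_step_def)
    then show ?thesis
    proof cases
      case (1 k)
      then have "mutate k t = u" using mutate_involution[of u k] seeds by simp
      then show ?thesis using laurent_star_mutate[OF t, of k] seeds by simp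
    next
      case (2 p)
      then have "permute_seed (inv p) t = u" by (simp add: permute_seed_inverse)
      then show ?thesis
        using laurent_star_permute[OF t bij_imp_bij_inv[OF \<open>bij p\<close>]] seeds by simp
    qed
  qed
qed

lemma cyclic_matrix_B_matrix:
  assumes "a \<ge> 2" shows "cyclic_matrix (B_matrix a)"
proof -
  have "transpose (B_matrix a) = - B_matrix a"
    by (simp add: vec_eq_iff transpose_def forall_3 B_matrix_def)
  \<comment> \<open>Equality holds for \<open>a = 2\<close>, which is where the bound 4 comes from;
    for \<open>a >= 3\<close> the left side is at most 0.\<close>
  moreover have "3 * (int a)\<^sup>2 - int a ^ 3 \<le> 4"
  proof (cases "a = 2")
    case False
    then have "int a ^ 2 * (3 - int a) \<le> 0" using assms by (intro mult_nonneg_nonpos) auto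
    then show ?thesis by (simp add: power2_eq_square power3_eq_cube algebra_simps)
  qed simp
  then have "(int a)\<^sup>2 + (int a)\<^sup>2 + (int a)\<^sup>2 - int a * int a * int a \<le> 4"
    by (simp add: power2_eq_square power3_eq_cube)
  ultimately show ?thesis
    unfolding cyclic_matrix_def using assms
    by (intro conjI exI[of _ "-1"] exI[of _ "int a"]) (auto simp: B_matrix_def)
qed

lemma markov_generators_laurent:
  assumes i: "independent3 u v w" and a: "a > 0"
    and M: "M = (u ^ a + v ^ a + w ^ a) / (u * v * w)"
  shows "{u, v, w, M} \<subseteq> laurent_ring {u, v, w}"
    and "{u, v, w, M} \<subseteq> laurent_ring {(v ^ a + w ^ a) / u, v, w}"
proof -
  note nz = independent3_neq_0[OF i]
  let ?L = "laurent_ring {u, v, w}"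
  have L: "is_subring ?L" by (rule is_subring_laurent_ring)
  have in_L: "u \<in> ?L" "v \<in> ?L" "w \<in> ?L" "inverse u \<in> ?L" "inverse v \<in> ?L" "inverse w \<in> ?L"
    by (auto intro: laurent_ring_var laurent_ring_inverse)
  have "M = (u ^ a + v ^ a + w ^ a) * (inverse u * inverse v * inverse w)"
    by (simp add: M divide_inverse)
  also have "\<dots> \<in> ?L"
    by (intro subring_mult[OF L] subring_add[OF L] subring_power[OF L] in_L)
  finally show "{u, v, w, M} \<subseteq> ?L" using in_L by simp
  define u' where "u' = (v ^ a + w ^ a) / u"
  have P0: "v ^ a + w ^ a \<noteq> 0"
    by (rule independent3_power_sum_neq_0[OF independent3_rotate[OF i] a])
  let ?L' = "laurent_ring {u', v, w}"
  have L': "is_subring ?L'" by (rule is_subring_laurent_ring)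
  have in_L': "u' \<in> ?L'" "v \<in> ?L'" "w \<in> ?L'" "inverse u' \<in> ?L'" "inverse v \<in> ?L'" "inverse w \<in> ?L'"
    by (auto intro: laurent_ring_var laurent_ring_inverse)
  have "u = (v ^ a + w ^ a) * inverse u'" using nz P0 by (simp add: u'_def)
  then have u: "u \<in> ?L'" using in_L' L' by (metis subring_mult subring_add subring_power)
  \<comment> \<open>One factor \<open>u\<close> cancels:
    \<open>M = (u^(a - 1) + u') / (v w)\<close>, and \<open>u\<close> itself is Laurent in the
    mutated cluster.\<close>
  have "M = (u ^ (a - 1) + u') * (inverse v * inverse w)"
    using a nz by (cases a) (auto simp: M u'_def field_simps)
  also have "\<dots> \<in> ?L'"
    by (intro subring_mult[OF L'] subring_add[OF L'] subring_power[OF L'] in_L' u)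
  finally show "{u, v, w, M} \<subseteq> laurent_ring {(v ^ a + w ^ a) / u, v, w}"
    using in_L' u unfolding u'_def[symmetric] by simp
qed

theorem proposition6p2p2:
  fixes a :: nat and x1 x2 x3 M :: "'f::field_char_0"
  assumes "a \<ge> 2"
    and "freely_generates (vector [x1, x2, x3] :: 'f ^ 3)"
    and "M = (x1 ^ a + x2 ^ a + x3 ^ a) / (x1 * x2 * x3)"
  shows "upper_cluster_algebra (vector [x1, x2, x3], B_matrix a) =
           subring_generated {x1, x2, x3, M} \<and>
         relation_ideal (vector [x1, x2, x3, M] :: 'f ^ 4) =
           ideal_generated
             {symb 1 * symb 2 * symb 3 * symb 4 - symb 1 ^ a - symb 2 ^ a - symb 3 ^ a}"
proof
  let ?x = "vector [x1, x2, x3] :: 'f ^ 3"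
  let ?s = "(?x, B_matrix a) :: ('f, 3) seed"
  have a: "a > 0" using assms(1) by simp
  have i: "independent3 x1 x2 x3"
    using freely_generates_independent3[OF assms(2), of 1 2 3] by simp
  note B = cyclic_matrix_B_matrix[OF assms(1)]
  have s: "is_seed ?s"
    using assms(2) B by (simp add: is_seed_def cyclic_matrix_def)
  have range_eq: "range (($) y) = {y $ 1, y $ 2, y $ 3}" for y :: "'f ^ 3"
    by (rule range_vec_3) auto
  have r0: "range (($) ?x) = {x1, x2, x3}"
    unfolding range_eq by simp
  have r1: "range (($) (mutate_vars 1 ?x (B_matrix a))) = {(x2 ^ a + x3 ^ a) / x1, x2, x3}"
    using mutate_vars_cyclic[OF B, of 2 3 1 ?x] unfolding range_eq by (simp add: B_matrix_def)
  have r2: "range (($) (mutate_vars 2 ?x (B_matrix a))) = {x1, (x1 ^ a + x3 ^ a) / x2, x3}"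
    using mutate_vars_cyclic[OF B, of 1 3 2 ?x] unfolding range_eq by (simp add: B_matrix_def)
  have r3: "range (($) (mutate_vars 3 ?x (B_matrix a))) = {x1, x2, (x1 ^ a + x2 ^ a) / x3}"
    using mutate_vars_cyclic[OF B, of 1 2 3 ?x] unfolding range_eq by (simp add: B_matrix_def)
  have seeds: "is_seed (mutate k ?s)" for k
  proof -
    obtain i j where "i \<noteq> j" "j \<noteq> k" "i \<noteq> k" by (rule ex_distinct_3)
    then show ?thesis using is_seed_mutate[OF s] B by simp
  qed
  show "upper_cluster_algebra ?s = subring_generated {x1, x2, x3, M}"
  proof
    have mem: "f \<in> laurent_ring (range (($) (fst t)))"
      if "f \<in> upper_cluster_algebra ?s" "mutation_equivalent ?s t" for f t
      using that unfolding upper_cluster_algebra_def clusters_def by blast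
    have "mutation_equivalent ?s (mutate k ?s)" for k
      unfolding mutation_equivalent_def seed_step_def using s seeds by (intro r_into_equivclp) blast
    then have "f \<in> laurent_ring (range (($) (mutate_vars k ?x (B_matrix a))))"
      if "f \<in> upper_cluster_algebra ?s" for f k
      using mem[OF that, of "mutate k ?s"] by (simp add: mutate_def)
    moreover have "f \<in> laurent_ring (range (($) ?x))" if "f \<in> upper_cluster_algebra ?s" for f
      using mem[OF that, of ?s] by (simp add: mutation_equivalent_def)
    ultimately show "upper_cluster_algebra ?s \<subseteq> subring_generated {x1, x2, x3, M}"
      using markov_upper_bound[OF i a assms(3)] r0 r1 r2 r3 by (metis subsetI)
  next
    have M2: "M = (x2 ^ a + x3 ^ a + x1 ^ a) / (x2 * x3 * x1)"
      and M3: "M = (x3 ^ a + x1 ^ a + x2 ^ a) / (x3 * x1 * x2)"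
      unfolding assms(3) by (simp_all add: ac_simps)
    let ?R = "{x1, x2, x3, M}"
    note gen1 = markov_generators_laurent[OF i a assms(3)]
    note gen2 = markov_generators_laurent(2)[OF independent3_rotate[OF i] a M2]
    note gen3 = markov_generators_laurent(2)[OF independent3_rotate[OF independent3_rotate[OF i]] a M3]
    have "?R \<subseteq> laurent_ring {x1, (x1 ^ a + x3 ^ a) / x2, x3}"
      using gen2 by (simp add: insert_commute add.commute)
    moreover have "?R \<subseteq> laurent_ring {x1, x2, (x1 ^ a + x2 ^ a) / x3}"
      using gen3 by (simp add: insert_commute add.commute)
    ultimately have "?R \<subseteq> laurent_ring (range (($) (fst (mutate k ?s))))" for k
      using gen1(2) exhaust_3[of k] by (auto simp: mutate_def r1 r2 r3)
    then have star: "laurent_star ?R ?s"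
      using s B gen1(1) unfolding laurent_star_def fst_conv snd_conv r0 by blast
    have "subring_generated ?R \<subseteq> laurent_ring (range (($) (fst t)))" if "mutation_equivalent ?s t" for t
      using laurent_star_equivalent[OF that star]
      by (intro subring_generated_least is_subring_laurent_ring) (simp add: laurent_star_def)
    then show "subring_generated ?R \<subseteq> upper_cluster_algebra ?s"
      unfolding upper_cluster_algebra_def clusters_def by blast
  qed
  show "relation_ideal (vector [x1, x2, x3, M] :: 'f ^ 4) =
      ideal_generated {symb 1 * symb 2 * symb 3 * symb 4 - symb 1 ^ a - symb 2 ^ a - symb 3 ^ a}"
    by (rule markov_relation_ideal[OF a assms(2,3)])
qed

end
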